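(* Let $M$ be a non-degenerate normalized convex Orlicz function. Then the unit vector system of the Orlicz sequence space $\ell_M$ verifies Lechner's condition if and only if $1<\alpha_M$.
   Context: $\mathbb{F}$ is the real or complex field. A normalized convex Orlicz function is a convex function $M\colon[0,\infty)\to[0,\infty)$ with $M(0)=0$ and $M(1)=1$; it is degenerate if it vanishes in a neighborhood of the origin, and non-degenerate otherwise. The Orlicz sequence space $\ell_M$ is the Banach space of all $f=(a_n)_{n=1}^\infty\in\mathbb{F}^{\mathbb{N}}$ with $\|f\|_{\ell_M}:=\inf\{t>0: \sum_{n=1}^\infty M(|a_n|/t)\le 1\}<\infty$. The unit vector system is $(\mathbf{e}_k)_{k=1}^\infty$, $\mathbf{e}_k=(\delta_{k,n})_{n=1}^\infty$; it is an unconditional basic sequence in $\ell_M$. For $b>0$ put $M_b(t)=M(bt)/M(b)$, $t\ge 0$, and \[ \alpha_M=\sup\Big\{q\in[1,\infty): \sup_{0<b,t\le 1} t^{-q}M_b(t)<\infty\Big\}. \] Lechner's condition. Let $(\mathbf{x}_j)_{j=1}^\infty$ be an unconditional basis of a Banach space $\mathbb{X}$, with sequence of coordinate functionals (dual basic sequence) $(\mathbf{x}_j^* )_{j=1}^\infty$. For $A\subseteq\mathbb{N}$ let $P_A(f)=\sum_{j\in A}\mathbf{x}_j^*(f)\,\mathbf{x}_j$ be the coordinate projection on $\mathbb{X}$, and $P_A^*$ its adjoint on $\mathbb{X}^*$. The sequence $(\mathbf{x}_j^* )_{j=1}^\infty$ verifies Lechner's condition if for every infinite $A\subseteq\mathbb{N}$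 and every $\theta>0$ there is a sequence $(A_n)_{n=1}^\infty$ of pairwise disjoint infinite subsets of $A$ such that for every sequence $(f_n^* )_{n=1}^\infty$ in the closed unit ball of $\mathbb{X}^*$ there is $(a_n)_{n=1}^\infty$ in the unit sphere of $\ell_1$ with $\|\sum_{n=1}^\infty a_n P_{A_n}^*(f_n^* )\|\le\theta$. An arbitrary unconditional basic sequence $\mathcal{B}$ (a basis of its closed linear span $\mathbb{Y}$) is said to satisfy Lechner's condition by regarding it as a dual basic sequence: let $\mathbb{X}$ be the closed linear span in $\mathbb{Y}^*$ of the coordinate functionals $\mathcal{B}^*$ of $\mathcal{B}$; then $\mathcal{B}^*$ is an unconditional basis of $\mathbb{X}$ and, via the natural isomorphic embedding of $\mathbb{Y}$ into $\mathbb{X}^*$, $\mathcal{B}$ is the dual basic sequence of $\mathcal{B}^*$; the condition is then the one above for the basis $\mathcal{B}^*$ of $\mathbb{X}$. *)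

theory Defs
  imports "HOL-Analysis.Analysis" "HOL-Library.Function_Algebras"
begin

section \<open>Normed spaces, duals and closed spans\<close>

text \<open>
  The Orlicz space depends on the function defining it, so it cannot be a type. A normed space over
  the scalar field \<open>'k\<close> (used only for the real and the complex numbers) is therefore
  given by a set of vectors in an ambient abelian group, a scalar multiplication and a norm, the
  latter being meaningful on the set of vectors only. For spaces of functions the ambient addition
  is the pointwise one of \<open>Function_Algebras\<close>.
\<close>

record ('k, 'v) nspace =
  vecs :: "'v set"
  smul :: "'k \<Rightarrow> 'v \<Rightarrow> 'v"
  nrm :: "'v \<Rightarrow> real"

definition fscale :: "'k \<Rightarrow> ('i \<Rightarrow> 'k) \<Rightarrow> 'i \<Rightarrow> 'k::times" where
  "fscale c f = (\<lambda>i. c * f i)"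

text \<open>
  The value 0 outside the space makes functionals that agree on the space equal.
\<close>

definition bounded_functional ::
    "('k::real_normed_field, 'v::ab_group_add) nspace \<Rightarrow> ('v \<Rightarrow> 'k) \<Rightarrow> bool" where
  "bounded_functional E \<phi> \<longleftrightarrow>
     (\<forall>x\<in>vecs E. \<forall>y\<in>vecs E. \<phi> (x + y) = \<phi> x + \<phi> y) \<and>
     (\<forall>c. \<forall>x\<in>vecs E. \<phi> (smul E c x) = c * \<phi> x) \<and>
     (\<exists>C. \<forall>x\<in>vecs E. norm (\<phi> x) \<le> C * nrm E x) \<and>
     (\<forall>x. x \<notin> vecs E \<longrightarrow> \<phi> x = 0)"

definition dual ::
    "('k::real_normed_field, 'v::ab_group_add) nspace \<Rightarrow> ('k, 'v \<Rightarrow> 'k) nspace" where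
  "dual E = \<lparr>vecs = Collect (bounded_functional E),
             smul = fscale,
             nrm = (\<lambda>\<phi>. Sup {norm (\<phi> x) | x. x \<in> vecs E \<and> nrm E x \<le> 1})\<rparr>"

definition closed_span ::
    "('k::real_normed_field, 'v::ab_group_add) nspace \<Rightarrow> (nat \<Rightarrow> 'v) \<Rightarrow> ('k, 'v) nspace" where
  "closed_span E x =
     E\<lparr>vecs := {v \<in> vecs E. \<forall>\<epsilon>>0. \<exists>u \<in> module.span (smul E) (range x). nrm E (v - u) < \<epsilon>}\<rparr>"

text \<open>Unconditional convergence in norm, as in the library's \<open>has_sum\<close>.\<close>

definition has_nsum ::
    "('k, 'v::ab_group_add) nspace \<Rightarrow> ('i \<Rightarrow> 'v) \<Rightarrow> 'v \<Rightarrow> 'i set \<Rightarrow> bool" where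
  "has_nsum E u v A \<longleftrightarrow>
     v \<in> vecs E \<and> ((\<lambda>F. nrm E (v - sum u F)) \<longlongrightarrow> 0) (finite_subsets_at_top A)"

section \<open>Lechner's condition\<close>

text \<open>
  Coordinate functionals and coordinate projections are meaningful when \<open>x\<close> is an
  unconditional basis of \<open>E\<close>: the former are then the unique bounded functionals
  biorthogonal to \<open>x\<close>, and the series defining the latter converge.
\<close>

definition coord ::
    "('k::real_normed_field, 'v::ab_group_add) nspace \<Rightarrow> (nat \<Rightarrow> 'v) \<Rightarrow> nat \<Rightarrow> 'v \<Rightarrow> 'k" where
  "coord E x j =
     (THE \<phi>. \<phi> \<in> vecs (dual E) \<and> (\<forall>k. \<phi> (x k) = (if k = j then 1 else 0)))"

definition coord_proj ::
    "('k::real_normed_field, 'v::ab_group_add) nspace \<Rightarrow> (nat \<Rightarrow> 'v) \<Rightarrow> nat set \<Rightarrow> 'v \<Rightarrow> 'v" where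
  "coord_proj E x A f = (THE g. has_nsum E (\<lambda>j. smul E (coord E x j f) (x j)) g A)"

definition adjoint_on ::
    "('k::real_normed_field, 'v) nspace \<Rightarrow> ('v \<Rightarrow> 'v) \<Rightarrow> ('v \<Rightarrow> 'k) \<Rightarrow> 'v \<Rightarrow> 'k" where
  "adjoint_on E T \<phi> = (\<lambda>f. if f \<in> vecs E then \<phi> (T f) else 0)"

text \<open>
  For an unconditional basis \<open>x\<close> of \<open>E\<close>: the dual basic sequence of \<open>x\<close> verifies
  Lechner's condition.
\<close>

definition dual_basis_lechner ::
    "('k::real_normed_field, 'v::ab_group_add) nspace \<Rightarrow> (nat \<Rightarrow> 'v) \<Rightarrow> bool" where
  "dual_basis_lechner E x \<longleftrightarrow>
     (\<forall>A. infinite A \<longrightarrow> (\<forall>\<theta>>0.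
        \<exists>B :: nat \<Rightarrow> nat set.
          disjoint_family B \<and> (\<forall>n. infinite (B n) \<and> B n \<subseteq> A) \<and>
          (\<forall>f :: nat \<Rightarrow> 'v \<Rightarrow> 'k.
             (\<forall>n. f n \<in> vecs (dual E) \<and> nrm (dual E) (f n) \<le> 1) \<longrightarrow>
             (\<exists>a :: nat \<Rightarrow> 'k.
                (\<lambda>n. norm (a n)) sums 1 \<and>
                (\<exists>s. has_nsum (dual E)
                        (\<lambda>n. smul (dual E) (a n) (adjoint_on E (coord_proj E x (B n)) (f n)))
                        s UNIV \<and>
                     nrm (dual E) s \<le> \<theta>)))))"

text \<open>
  For an unconditional basic sequence \<open>b\<close> in \<open>E\<close>, regarded as the dual basic sequence
  of its coordinate functionals.
\<close>

definition lechner_condition ::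
    "('k::real_normed_field, 'v::ab_group_add) nspace \<Rightarrow> (nat \<Rightarrow> 'v) \<Rightarrow> bool" where
  "lechner_condition E b \<longleftrightarrow>
     (let Y = closed_span E b;
          b' = coord Y b;
          X = closed_span (dual Y) b'
      in dual_basis_lechner X b')"

section \<open>Orlicz sequence spaces\<close>

definition normalized_convex_orlicz :: "(real \<Rightarrow> real) \<Rightarrow> bool" where
  "normalized_convex_orlicz M \<longleftrightarrow>
     convex_on {0..} M \<and> (\<forall>t\<ge>0. 0 \<le> M t) \<and> M 0 = 0 \<and> M 1 = 1"

definition degenerate :: "(real \<Rightarrow> real) \<Rightarrow> bool" where
  "degenerate M \<longleftrightarrow> (\<exists>\<epsilon>>0. \<forall>t. 0 \<le> t \<and> t < \<epsilon> \<longrightarrow> M t = 0)"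

definition orlicz_radii :: "(real \<Rightarrow> real) \<Rightarrow> (nat \<Rightarrow> 'k::real_normed_field) \<Rightarrow> real set" where
  "orlicz_radii M f = {t. 0 < t \<and> (\<Sum>n. ennreal (M (norm (f n) / t))) \<le> 1}"

text \<open>Finiteness of the extended-valued norm means that the set of admissible radii is nonempty.\<close>

definition orlicz_space ::
    "(real \<Rightarrow> real) \<Rightarrow> ('k::real_normed_field, nat \<Rightarrow> 'k) nspace" where
  "orlicz_space M = \<lparr>vecs = {f. orlicz_radii M f \<noteq> {}},
                     smul = fscale,
                     nrm = (\<lambda>f. Inf (orlicz_radii M f))\<rparr>"

definition unit_vector :: "nat \<Rightarrow> nat \<Rightarrow> 'k::zero_neq_one" where
  "unit_vector k = (\<lambda>n. if n = k then 1 else 0)"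

definition orlicz_dilate :: "(real \<Rightarrow> real) \<Rightarrow> real \<Rightarrow> real \<Rightarrow> real" where
  "orlicz_dilate M b t = M (b * t) / M b"

text \<open>The supremum may be infinite.\<close>

definition orlicz_alpha :: "(real \<Rightarrow> real) \<Rightarrow> ereal" where
  "orlicz_alpha M =
     (SUP q \<in> {q. 1 \<le> q \<and>
                  bdd_above {t powr (- q) * orlicz_dilate M b t | b t.
                               0 < b \<and> b \<le> 1 \<and> 0 < t \<and> t \<le> 1}}. ereal q)"

end

theory Submission
  imports Defs
begin

text \<open>
  Write \<open>Y\<close> for the closed span of the unit vectors in \<open>\<ell>\<^sub>M\<close> and \<open>X\<close> for the closed
  span of the coordinate functionals \<open>ev j\<close> in the dual of \<open>Y\<close>. A functional on \<open>X\<close> is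
  determined by its values at the \<open>ev j\<close>, and it has norm at most \<open>r\<close> exactly when every finite
  section of this sequence of values, divided by \<open>r\<close>, has Orlicz modular at most 1. So Lechner's
  condition is about disjoint sequences and the modular only.

  If \<open>M (b * t) \<le> C * t\<^sup>q * M b\<close> with \<open>q > 1\<close>, then the average of \<open>N\<close> disjoint vectors of the unit
  ball has modular at most \<open>C * N powr (1 - q)\<close>, and Lechner's condition holds for any partition.
  If there is no such bound, then for every \<open>\<delta>\<close> some \<open>u\<close> satisfies \<open>M (u * \<delta>) \<ge> \<delta> / 2 * M u\<close>, for
  otherwise iteration would give a bound with exponent \<open>q > 1\<close>. Since \<open>M t / t\<close> is increasing, a
  multiple of an indicator function with value \<open>u\<close> then has a modular that is almost linear down to
  \<open>\<delta>\<close>, and a sequence of such vectors is equivalent to the unit vectors of \<open>\<ell>\<^sub>1\<close>.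
\<close>

section \<open>Duals and closed spans of normed spaces\<close>

lemma module_fscale: "module (fscale :: 'k::comm_ring_1 \<Rightarrow> ('i \<Rightarrow> 'k) \<Rightarrow> 'i \<Rightarrow> 'k)"
  by unfold_locales (auto simp: fscale_def fun_eq_iff algebra_simps)

lemma closed_span_simps [simp]:
  "smul (closed_span E x) = smul E" "nrm (closed_span E x) = nrm E"
  by (simp_all add: closed_span_def)

text \<open>The norm axioms speak of \<open>vecs E\<close> only, since the ambient group may be
  larger. Nonnegativity is derived, from the triangle inequality for a vector and its
  negative.\<close>

locale norm_space = module "smul E" for E :: "('k::real_normed_field, 'v::ab_group_add) nspace" +
  assumes subspace_vecs: "subspace (vecs E)"
    and nrm_eq_0: "x \<in> vecs E \<Longrightarrow> nrm E x = 0 \<Longrightarrow> x = 0"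
    and nrm_smul: "x \<in> vecs E \<Longrightarrow> nrm E (smul E c x) = norm c * nrm E x"
    and nrm_add: "x \<in> vecs E \<Longrightarrow> y \<in> vecs E \<Longrightarrow> nrm E (x + y) \<le> nrm E x + nrm E y"
begin

lemma nrm_0 [simp]: "nrm E 0 = 0"
  using nrm_smul[of 0 0] subspace_0[OF subspace_vecs] by simp

lemma nrm_minus: "x \<in> vecs E \<Longrightarrow> nrm E (- x) = nrm E x"
  using nrm_smul[of x "-1"] by simp

lemma nrm_ge_0: "x \<in> vecs E \<Longrightarrow> 0 \<le> nrm E x"
  using nrm_add[of x "- x"] nrm_minus[of x] subspace_neg[OF subspace_vecs, of x] by simp

lemma nrm_diff: "x \<in> vecs E \<Longrightarrow> y \<in> vecs E \<Longrightarrow> nrm E (x - y) \<le> nrm E x + nrm E y"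
  using nrm_add[of x "- y"] nrm_minus[of y] subspace_neg[OF subspace_vecs, of y] by simp

text \<open>Limits are compared through a common partial sum. Uniqueness gives the definite
  description in \<open>coord_proj\<close> its value.\<close>

lemma has_nsum_unique:
  assumes "has_nsum E u v A" "has_nsum E u w A" "\<And>i. i \<in> A \<Longrightarrow> u i \<in> vecs E"
  shows "v = w"
proof -
  have v: "v \<in> vecs E" and w: "w \<in> vecs E"
    using assms by (auto simp: has_nsum_def)
  have le: "nrm E (v - w) \<le> nrm E (v - sum u F) + nrm E (w - sum u F)"
    if "finite F" "F \<subseteq> A" for F
  proof -
    have "sum u F \<in> vecs E"
      using that assms(3) by (intro subspace_sum[OF subspace_vecs]) auto
    then show ?thesis
      using nrm_diff[of "v - sum u F" "w - sum u F"] v w subspace_diff[OF subspace_vecs] by simp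
  qed
  have "((\<lambda>F. nrm E (v - sum u F) + nrm E (w - sum u F)) \<longlongrightarrow> 0 + 0) (finite_subsets_at_top A)"
    using assms unfolding has_nsum_def by (intro tendsto_add) blast+
  then have "nrm E (v - w) \<le> 0 + 0"
  proof (rule tendsto_lowerbound)
    show "\<forall>\<^sub>F F in finite_subsets_at_top A.
        nrm E (v - w) \<le> nrm E (v - sum u F) + nrm E (w - sum u F)"
      by (rule eventually_finite_subsets_at_top_weakI) (rule le)
  qed simp
  then show ?thesis
    using nrm_eq_0[of "v - w"] nrm_ge_0[of "v - w"] v w subspace_diff[OF subspace_vecs, of v w] by simp
qed

text \<open>The net of partial sums is constant from \<open>S\<close> on. This supplies the sum when
  Lechner's condition is met with finitely many nonzero coefficients.\<close>

lemma has_nsum_finite_support: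
  assumes "finite S" "S \<subseteq> A" "\<And>i. i \<in> A - S \<Longrightarrow> u i = 0" "\<And>i. i \<in> S \<Longrightarrow> u i \<in> vecs E"
  shows "has_nsum E u (sum u S) A"
proof -
  have "sum u F = sum u S" if "finite F" "F \<subseteq> A" "S \<subseteq> F" for F
    using that assms(3) by (intro sum.mono_neutral_right) auto
  then have "\<forall>\<^sub>F F in finite_subsets_at_top A. nrm E (sum u S - sum u F) = 0"
    unfolding eventually_finite_subsets_at_top using assms(1,2)
    by (metis diff_self nrm_0)
  then have "((\<lambda>F. nrm E (sum u S - sum u F)) \<longlongrightarrow> 0) (finite_subsets_at_top A)"
    by (rule tendsto_eventually)
  moreover have "sum u S \<in> vecs E"
    using assms(4) by (rule subspace_sum[OF subspace_vecs])
  ultimately show ?thesis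
    by (simp add: has_nsum_def)
qed

lemma span_range_explicit:
  assumes "v \<in> span (range x)"
  obtains F :: "nat set" and c where "finite F" "v = (\<Sum>j\<in>F. smul E (c j) (x j))"
proof -
  have "\<exists>(F::nat set) c. finite F \<and> v = (\<Sum>j\<in>F. smul E (c j) (x j))"
    using assms
  proof (induction rule: span_induct_alt)
    case base
    then show ?case by (intro exI[of _ "{}"]) simp
  next
    case (step a y z)
    then obtain F c k where F: "finite F" "z = (\<Sum>j\<in>F. smul E (c j) (x j))" "y = x k"
      by auto
    \<comment> \<open>The index \<open>k\<close> may already occur in \<open>F\<close>, so the new
      coefficient is added to the old one.\<close>
    define d where "d j = (if j \<in> F then c j else 0) + (if j = k then a else 0)" for j
    have "(\<Sum>j\<in>insert k F. smul E (d j) (x j))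
        = (\<Sum>j\<in>insert k F. if j \<in> F then smul E (c j) (x j) else 0)
        + (\<Sum>j\<in>insert k F. if j = k then smul E a (x j) else 0)"
      unfolding sum.distrib[symmetric]
      by (intro sum.cong) (auto simp: d_def scale_left_distrib)
    also have "(\<Sum>j\<in>insert k F. if j \<in> F then smul E (c j) (x j) else 0) = z"
      unfolding F(2) using F(1) by (intro sum.mono_neutral_cong_right) auto
    also have "(\<Sum>j\<in>insert k F. if j = k then smul E a (x j) else 0) = smul E a y"
      using F by simp
    finally have "smul E a y + z = (\<Sum>j\<in>insert k F. smul E (d j) (x j))"
      by (simp add: add.commute)
    then show ?case
      using F(1) by blast
  qed
  then show ?thesis
    using that by blast
qed

section \<open>Bounded functionals and the dual norm\<close>

lemma
  assumes "bounded_functional E \<phi>"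
  shows bounded_functional_add: "x \<in> vecs E \<Longrightarrow> y \<in> vecs E \<Longrightarrow> \<phi> (x + y) = \<phi> x + \<phi> y"
    and bounded_functional_smul: "x \<in> vecs E \<Longrightarrow> \<phi> (smul E c x) = c * \<phi> x"
    and bounded_functional_0: "\<phi> 0 = 0"
    and bounded_functional_diff: "x \<in> vecs E \<Longrightarrow> y \<in> vecs E \<Longrightarrow> \<phi> (x - y) = \<phi> x - \<phi> y"
proof -
  show add: "\<phi> (x + y) = \<phi> x + \<phi> y" if "x \<in> vecs E" "y \<in> vecs E" for x y
    using assms that by (auto simp: bounded_functional_def)
  show smul: "\<phi> (smul E c x) = c * \<phi> x" if "x \<in> vecs E" for x c
    using assms that by (auto simp: bounded_functional_def)
  show "\<phi> 0 = 0"
    using smul[of 0 0] subspace_0[OF subspace_vecs] by simp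
  show "\<phi> (x - y) = \<phi> x - \<phi> y" if "x \<in> vecs E" "y \<in> vecs E" for x y
    using add[of "x - y" y] that subspace_diff[OF subspace_vecs] by simp
qed

lemma bounded_functional_sum:
  assumes "bounded_functional E \<phi>" "\<And>i. i \<in> F \<Longrightarrow> u i \<in> vecs E"
  shows "\<phi> (\<Sum>i\<in>F. smul E (c i) (u i)) = (\<Sum>i\<in>F. c i * \<phi> (u i))"
  using assms(2)
proof (induction F rule: infinite_finite_induct)
  case (insert i F)
  then have "(\<Sum>i\<in>F. smul E (c i) (u i)) \<in> vecs E"
    by (intro subspace_sum[OF subspace_vecs] subspace_scale[OF subspace_vecs]) auto
  with insert show ?case
    using assms(1) subspace_scale[OF subspace_vecs]
    by (simp add: bounded_functional_add bounded_functional_smul)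
qed (use assms(1) in \<open>auto simp: bounded_functional_0\<close>)

text \<open>The real-valued \<open>Sup\<close> is an upper bound only for a set bounded above, which
  the constant \<open>C\<close> guarantees; the rest is normalisation of \<open>x\<close>. Norm zero
  is split off because such a vector cannot be normalised.\<close>

lemma norm_le_nrm_dual:
  assumes "bounded_functional E \<phi>" "x \<in> vecs E"
  shows "norm (\<phi> x) \<le> nrm (dual E) \<phi> * nrm E x"
proof (cases "nrm E x = 0")
  case True
  then have "x = 0"
    using assms nrm_eq_0 by blast
  then show ?thesis
    using assms(1) by (simp add: bounded_functional_0)
next
  case False
  then have pos: "nrm E x > 0"
    using nrm_ge_0 assms(2) by (simp add: less_le)
  obtain C where C: "norm (\<phi> y) \<le> C * nrm E y" if "y \<in> vecs E" for y
    using assms unfolding bounded_functional_def by blast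
  have "norm (\<phi> y) \<le> \<bar>C\<bar>" if "y \<in> vecs E" "nrm E y \<le> 1" for y
  proof -
    have "C * nrm E y \<le> \<bar>C\<bar> * 1"
      using that nrm_ge_0[of y] by (intro mult_mono) auto
    then show ?thesis
      using C[OF that(1)] by linarith
  qed
  then have bdd: "bdd_above {norm (\<phi> y) | y. y \<in> vecs E \<and> nrm E y \<le> 1}"
    by (intro bdd_aboveI[of _ "\<bar>C\<bar>"]) auto
  define y where "y = smul E (of_real (inverse (nrm E x))) x"
  have "y \<in> vecs E" "nrm E y = 1"
    using assms pos by (auto simp: y_def nrm_smul norm_inverse intro: subspace_scale[OF subspace_vecs])
  then have "norm (\<phi> y) \<le> nrm (dual E) \<phi>"
    unfolding dual_def using bdd by (auto intro!: cSup_upper)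
  moreover have "norm (\<phi> y) = norm (\<phi> x) / nrm E x"
    using assms pos by (simp add: y_def bounded_functional_smul norm_mult divide_inverse norm_inverse)
  ultimately show ?thesis
    using pos by (simp add: field_simps)
qed

lemma nrm_dual_le:
  assumes "\<And>x. x \<in> vecs E \<Longrightarrow> nrm E x \<le> 1 \<Longrightarrow> norm (\<phi> x) \<le> r"
  shows "nrm (dual E) \<phi> \<le> r"
  unfolding dual_def using assms subspace_0[OF subspace_vecs]
  by (auto intro!: cSup_least exI[of _ 0])

lemma nrm_dual_le':
  assumes "\<And>x. x \<in> vecs E \<Longrightarrow> norm (\<phi> x) \<le> r * nrm E x" "0 \<le> r"
  shows "nrm (dual E) \<phi> \<le> r"
proof (rule nrm_dual_le)
  fix x assume "x \<in> vecs E" "nrm E x \<le> 1"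
  then show "norm (\<phi> x) \<le> r"
    using assms(1)[of x] mult_left_mono[of "nrm E x" 1 r] assms(2) by simp
qed

lemma norm_space_dual: "norm_space (dual E)"
proof -
  interpret D: module "smul (dual E)"
    by (simp add: dual_def module_fscale)
  have vecs: "\<phi> \<in> vecs (dual E) \<longleftrightarrow> bounded_functional E \<phi>" for \<phi>
    by (simp add: dual_def)
  have smul: "smul (dual E) = fscale"
    by (simp add: dual_def)
  have add_le: "norm (\<phi> x + \<psi> x) \<le> (nrm (dual E) \<phi> + nrm (dual E) \<psi>) * nrm E x"
    if "bounded_functional E \<phi>" "bounded_functional E \<psi>" "x \<in> vecs E" for \<phi> \<psi> x
    using norm_triangle_ineq[of "\<phi> x" "\<psi> x"] norm_le_nrm_dual[OF that(1,3)]
      norm_le_nrm_dual[OF that(2,3)] by (simp add: distrib_right)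
  have scale_le: "norm (c * \<phi> x) \<le> (norm c * nrm (dual E) \<phi>) * nrm E x"
    if "bounded_functional E \<phi>" "x \<in> vecs E" for \<phi> c x
    using mult_left_mono[OF norm_le_nrm_dual[OF that], of "norm c"] by (simp add: norm_mult)
  have ge0: "0 \<le> nrm (dual E) \<phi>" if "bounded_functional E \<phi>" for \<phi>
  proof -
    have "0 \<le> nrm (dual E) \<phi> * nrm E x" if "x \<in> vecs E" for x
      using norm_le_nrm_dual[OF \<open>bounded_functional E \<phi>\<close> that] norm_ge_zero order_trans by blast
    then show ?thesis
    proof (cases "\<exists>x\<in>vecs E. nrm E x \<noteq> 0")
      case True
      then obtain x where "x \<in> vecs E" "nrm E x > 0"
        using nrm_ge_0 by force
      then show ?thesis
        using \<open>x \<in> vecs E \<Longrightarrow> 0 \<le> nrm (dual E) \<phi> * nrm E x\<close> by (simp add: zero_le_mult_iff)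
    next
      \<comment> \<open>Here the space is trivial and the supremum is taken over the single value
        0.\<close>
      case False
      then have "x = 0" if "x \<in> vecs E" for x
        using that nrm_eq_0 by blast
      then have "{norm (\<phi> x) |x. x \<in> vecs E \<and> nrm E x \<le> 1} = {0}"
        using bounded_functional_0[OF that] subspace_0[OF subspace_vecs] by force
      then show ?thesis
        by (simp add: dual_def)
    qed
  qed
  have add_bf: "bounded_functional E (\<phi> + \<psi>)"
    if "bounded_functional E \<phi>" "bounded_functional E \<psi>" for \<phi> \<psi>
    unfolding bounded_functional_def
  proof (intro conjI)
    show "\<exists>C. \<forall>x\<in>vecs E. norm ((\<phi> + \<psi>) x) \<le> C * nrm E x"
      using add_le[OF that] by auto
  qed (use that in \<open>auto simp: bounded_functional_def algebra_simps\<close>)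
  have scale_bf: "bounded_functional E (fscale c \<phi>)" if "bounded_functional E \<phi>" for c \<phi>
    unfolding bounded_functional_def
  proof (intro conjI)
    show "\<exists>C. \<forall>x\<in>vecs E. norm (fscale c \<phi> x) \<le> C * nrm E x"
      using scale_le[OF that] by (auto simp: fscale_def)
  qed (use that in \<open>auto simp: bounded_functional_def fscale_def algebra_simps\<close>)
  have zero_bf: "bounded_functional E 0"
    by (auto simp: bounded_functional_def intro!: exI[of _ 0])
  have scale_nrm_le: "nrm (dual E) (fscale c \<phi>) \<le> norm c * nrm (dual E) \<phi>"
    if "bounded_functional E \<phi>" for c \<phi>
    using scale_le[OF that] ge0[OF that] by (intro nrm_dual_le') (auto simp: fscale_def)
  show ?thesis
  proof
    show "D.subspace (vecs (dual E))"
      by (rule D.subspaceI) (auto simp: vecs smul zero_bf intro: add_bf scale_bf)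
  next
    fix \<phi> assume \<phi>: "\<phi> \<in> vecs (dual E)" "nrm (dual E) \<phi> = 0"
    have "\<phi> x = 0" for x
    proof (cases "x \<in> vecs E")
      case True
      then show ?thesis
        using norm_le_nrm_dual[of \<phi> x] \<phi> by (simp add: vecs)
    next
      case False
      then show ?thesis
        using \<phi> by (simp add: vecs bounded_functional_def)
    qed
    then show "\<phi> = 0" by auto
  next
    fix \<phi> c assume \<phi>: "\<phi> \<in> vecs (dual E)"
    show "nrm (dual E) (smul (dual E) c \<phi>) = norm c * nrm (dual E) \<phi>"
    proof (cases "c = 0")
      case True
      then show ?thesis
        using scale_nrm_le[of \<phi> 0] ge0[OF scale_bf, of \<phi> 0] \<phi> by (simp add: vecs smul)
    next
      case False
      \<comment> \<open>The reverse inequality is the first one, applied to \<open>inverse c\<close>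
        and the scaled functional.\<close>
      have "nrm (dual E) \<phi> \<le> norm (inverse c) * nrm (dual E) (fscale c \<phi>)"
        using scale_nrm_le[of "fscale c \<phi>" "inverse c"] scale_bf \<phi> False
        by (simp add: vecs fscale_def mult.assoc[symmetric])
      then have "norm c * nrm (dual E) \<phi> \<le> nrm (dual E) (fscale c \<phi>)"
        using False by (simp add: norm_inverse norm_divide field_simps)
      then show ?thesis
        using scale_nrm_le[of \<phi> c] \<phi> by (simp add: vecs smul)
    qed
  next
    fix \<phi> \<psi> assume "\<phi> \<in> vecs (dual E)" "\<psi> \<in> vecs (dual E)"
    then show "nrm (dual E) (\<phi> + \<psi>) \<le> nrm (dual E) \<phi> + nrm (dual E) \<psi>"
      using add_le ge0 by (intro nrm_dual_le') (auto simp: vecs)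
  qed
qed

section \<open>Closed spans and density\<close>

context
  fixes x :: "nat \<Rightarrow> 'v"
  assumes x: "\<And>j. x j \<in> vecs E"
begin

lemma span_subset_vecs: "span (range x) \<subseteq> vecs E"
  using x by (intro span_minimal subspace_vecs) auto

lemma vecs_closed_span:
  "vecs (closed_span E x) = {v \<in> vecs E. \<forall>\<epsilon>>0. \<exists>u \<in> span (range x). nrm E (v - u) < \<epsilon>}"
  by (simp add: closed_span_def)

lemma vecs_closed_span_subset: "vecs (closed_span E x) \<subseteq> vecs E"
  by (auto simp: vecs_closed_span)

lemma span_subset_closed_span: "span (range x) \<subseteq> vecs (closed_span E x)"
  using span_subset_vecs by (force simp: vecs_closed_span)

lemma base_in_closed_span: "x j \<in> vecs (closed_span E x)"
  using span_subset_closed_span span_base by blast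

lemma norm_space_closed_span: "norm_space (closed_span E x)"
proof -
  have V: "v \<in> vecs E" if "v \<in> span (range x)" for v
    using that span_subset_vecs by blast
  have "subspace (vecs (closed_span E x))"
  proof (rule subspaceI)
    show "0 \<in> vecs (closed_span E x)"
      using span_zero span_subset_closed_span by blast
  next
    fix v w assume vw: "v \<in> vecs (closed_span E x)" "w \<in> vecs (closed_span E x)"
    have "\<exists>u \<in> span (range x). nrm E (v + w - u) < \<epsilon>" if \<epsilon>: "\<epsilon> > 0" for \<epsilon>
    proof -
      obtain u where u: "u \<in> span (range x)" "nrm E (v - u) < \<epsilon> / 2"
        using vw half_gt_zero[OF \<epsilon>] unfolding vecs_closed_span by blast
      obtain u' where u': "u' \<in> span (range x)" "nrm E (w - u') < \<epsilon> / 2"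
        using vw half_gt_zero[OF \<epsilon>] unfolding vecs_closed_span by blast
      have "nrm E (v + w - (u + u')) \<le> nrm E (v - u) + nrm E (w - u')"
        using nrm_add[of "v - u" "w - u'"] vw u u' V vecs_closed_span_subset
          subspace_diff[OF subspace_vecs]
        by (auto simp: algebra_simps)
      then show ?thesis
        using u u' by (intro bexI[of _ "u + u'"] span_add) auto
    qed
    then show "v + w \<in> vecs (closed_span E x)"
      using vw subspace_add[OF subspace_vecs] by (auto simp: vecs_closed_span)
  next
    fix c v assume v: "v \<in> vecs (closed_span E x)"
    have "\<exists>u \<in> span (range x). nrm E (smul E c v - u) < \<epsilon>" if "\<epsilon> > 0" for \<epsilon>
    proof -
      \<comment> \<open>The summand 1 keeps the denominator positive when \<open>c\<close> is
        0.\<close>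
      have "\<epsilon> / (norm c + 1) > 0"
        using that by (intro divide_pos_pos) (auto intro: add_nonneg_pos)
      then obtain u where u: "u \<in> span (range x)" "nrm E (v - u) < \<epsilon> / (norm c + 1)"
        using v unfolding vecs_closed_span by blast
      have mem: "v - u \<in> vecs E"
        using v u V vecs_closed_span_subset subspace_diff[OF subspace_vecs] by blast
      have "nrm E (smul E c v - smul E c u) = norm c * nrm E (v - u)"
        using nrm_smul[OF mem, of c] by (simp add: scale_right_diff_distrib)
      also have "\<dots> \<le> (norm c + 1) * nrm E (v - u)"
        using nrm_ge_0[OF mem] by (intro mult_right_mono) auto
      also have "\<dots> < \<epsilon>"
        using u(2) by (subst (asm) pos_less_divide_eq) (auto simp: mult.commute add_nonneg_pos)
      finally show ?thesis
        using u by (intro bexI[of _ "smul E c u"] span_scale) auto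
    qed
    then show "smul E c v \<in> vecs (closed_span E x)"
      using v subspace_scale[OF subspace_vecs] by (auto simp: vecs_closed_span)
  qed
  then show ?thesis
    using vecs_closed_span_subset
    by (intro norm_space.intro norm_space_axioms.intro)
       (auto intro: module_axioms nrm_eq_0 nrm_smul nrm_add)
qed

text \<open>Continuity carries a bound from the span to its closure, with the same constant
  \<open>r\<close>. With \<open>r = 0\<close> it gives uniqueness of functionals, with general
  \<open>r\<close> the norm estimates.\<close>

lemma bounded_functional_closed_span_le:
  assumes \<phi>: "bounded_functional (closed_span E x) \<phi>"
    and le: "\<And>u. u \<in> span (range x) \<Longrightarrow> norm (\<phi> u) \<le> r * nrm E u"
    and r: "0 \<le> r"
    and v: "v \<in> vecs (closed_span E x)"
  shows "norm (\<phi> v) \<le> r * nrm E v"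
proof (rule field_le_epsilon)
  interpret C: norm_space "closed_span E x"
    by (rule norm_space_closed_span)
  define K where "K = nrm (dual (closed_span E x)) \<phi>"
  fix \<epsilon> :: real assume "\<epsilon> > 0"
  \<comment> \<open>The error of the approximation enters twice, once through the norm
    \<open>K\<close> of the functional and once through \<open>r\<close>; the summand 1 again guards
    the division.\<close>
  then have "\<epsilon> / (\<bar>K\<bar> + r + 1) > 0"
    using r by (intro divide_pos_pos) (auto intro: add_nonneg_pos)
  then obtain u where u: "u \<in> span (range x)" "nrm E (v - u) < \<epsilon> / (\<bar>K\<bar> + r + 1)"
    using v unfolding vecs_closed_span by blast
  have u': "u \<in> vecs (closed_span E x)"
    using u span_subset_closed_span by blast
  have vu: "v - u \<in> vecs (closed_span E x)"
    using C.subspace_diff[OF C.subspace_vecs] u' v by simp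
  have ge: "nrm E (v - u) \<ge> 0"
    using C.nrm_ge_0[OF vu] by simp
  have "nrm E (v - u) * (\<bar>K\<bar> + r + 1) < \<epsilon>"
    using u(2) r by (subst (asm) pos_less_divide_eq) auto
  then have small: "(\<bar>K\<bar> + r) * nrm E (v - u) \<le> \<epsilon>"
    using ge by (simp add: algebra_simps)
  have "norm (\<phi> v) \<le> norm (\<phi> (v - u)) + norm (\<phi> u)"
    using C.bounded_functional_diff[OF \<phi> v u'] norm_triangle_ineq[of "\<phi> (v - u)" "\<phi> u"] by simp
  also have "norm (\<phi> (v - u)) \<le> \<bar>K\<bar> * nrm E (v - u)"
    using C.norm_le_nrm_dual[OF \<phi> vu] mult_right_mono[OF abs_ge_self ge, of K]
    by (simp add: K_def)
  also have "norm (\<phi> u) \<le> r * (nrm E v + nrm E (v - u))"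
  proof -
    have "nrm E u \<le> nrm E v + nrm E (v - u)"
      using C.nrm_diff[OF v vu] by simp
    then show ?thesis
      using le[OF u(1)] r mult_left_mono order_trans by blast
  qed
  finally show "norm (\<phi> v) \<le> r * nrm E v + \<epsilon>"
    using small by (simp add: algebra_simps)
qed

lemma bounded_functional_closed_span_eqI:
  assumes \<phi>: "bounded_functional (closed_span E x) \<phi>"
    and \<psi>: "bounded_functional (closed_span E x) \<psi>"
    and eq: "\<And>j. \<phi> (x j) = \<psi> (x j)"
  shows "\<phi> = \<psi>"
proof -
  interpret C: norm_space "closed_span E x"
    by (rule norm_space_closed_span)
  interpret D: norm_space "dual (closed_span E x)"
    by (rule C.norm_space_dual)
  have vecs: "\<phi> \<in> vecs (dual (closed_span E x)) \<longleftrightarrow> bounded_functional (closed_span E x) \<phi>" for \<phi>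
    by (simp add: dual_def)
  have diff: "bounded_functional (closed_span E x) (\<phi> - \<psi>)"
    using D.subspace_diff[OF D.subspace_vecs, of \<phi> \<psi>] \<phi> \<psi> by (simp add: vecs)
  have "\<phi> v - \<psi> v = 0" for v
  proof (cases "v \<in> vecs (closed_span E x)")
    case True
    have "norm ((\<phi> - \<psi>) v) \<le> 0 * nrm E v"
    proof (rule bounded_functional_closed_span_le[OF diff _ _ True])
      fix u assume "u \<in> span (range x)"
      then obtain F and c :: "nat \<Rightarrow> 'k" where "finite F" "u = (\<Sum>j\<in>F. smul E (c j) (x j))"
        by (rule span_range_explicit)
      then have "(\<phi> - \<psi>) u = 0"
        using C.bounded_functional_sum[OF diff, of F x c] base_in_closed_span eq by simp
      then show "norm ((\<phi> - \<psi>) u) \<le> 0 * nrm E u"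
        by simp
    qed simp
    then show ?thesis by simp
  next
    case False
    then show ?thesis
      using \<phi> \<psi> by (simp add: bounded_functional_def)
  qed
  then show ?thesis by auto
qed

text \<open>Biorthogonality prescribes the values on the span, and density does the rest, so
  exhibiting one bounded biorthogonal functional evaluates the definite description in
  \<open>coord\<close>.\<close>

lemma coord_closed_span_eqI:
  assumes "bounded_functional (closed_span E x) \<phi>" "\<And>k. \<phi> (x k) = (if k = j then 1 else 0)"
  shows "coord (closed_span E x) x j = \<phi>"
  unfolding coord_def
proof (rule the_equality)
  show "\<phi> \<in> vecs (dual (closed_span E x)) \<and> (\<forall>k. \<phi> (x k) = (if k = j then 1 else 0))"
    using assms by (simp add: dual_def)
next
  fix \<psi>
  assume "\<psi> \<in> vecs (dual (closed_span E x)) \<and> (\<forall>k. \<psi> (x k) = (if k = j then 1 else 0))"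
  then show "\<psi> = \<phi>"
    using assms by (intro bounded_functional_closed_span_eqI) (simp_all add: dual_def)
qed

end

end

section \<open>The Orlicz norm\<close>

locale orlicz_function =
  fixes M :: "real \<Rightarrow> real"
  assumes orlicz: "normalized_convex_orlicz M"
begin

section \<open>Consequences of convexity\<close>

lemma M_0 [simp]: "M 0 = 0" and M_1 [simp]: "M 1 = 1"
  and M_nonneg: "0 \<le> t \<Longrightarrow> 0 \<le> M t"
  and convex_M: "convex_on {0..} M"
  using orlicz by (auto simp: normalized_convex_orlicz_def)

text \<open>Convexity along the chord from the origin, where \<open>M\<close> vanishes.
  Equivalently, \<open>M t / t\<close> is nondecreasing on the positive axis.\<close>

lemma M_mult_le:
  assumes "0 \<le> s" "s \<le> 1" "0 \<le> x"
  shows "M (s * x) \<le> s * M x"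
  using convex_onD[OF convex_M, of s 0 x] assms by simp

lemma M_mono:
  assumes "0 \<le> x" "x \<le> y"
  shows "M x \<le> M y"
proof (cases "y = 0")
  case False
  then have "M (x / y * y) \<le> x / y * M y"
    using assms by (intro M_mult_le) auto
  also have "\<dots> \<le> 1 * M y"
    using assms False M_nonneg[of y] by (intro mult_right_mono) auto
  finally show ?thesis
    using False by simp
qed (use assms in auto)

text \<open>Beyond 1 the chord from the origin through the normalisation \<open>M 1 = 1\<close> lies
  below \<open>M\<close>, so \<open>M x\<close> is at least \<open>x\<close> there.\<close>

lemma le_1_if_M_le_1:
  assumes "0 \<le> x" "M x \<le> 1"
  shows "x \<le> 1"
proof (rule ccontr)
  assume "\<not> x \<le> 1"
  then have x: "x > 1" by simp
  have "M (1 / x * x) \<le> 1 / x * M x"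
    using x by (intro M_mult_le) auto
  also have "\<dots> \<le> 1 / x * 1"
    using x assms by (intro mult_left_mono) auto
  finally show False
    using x by simp
qed

lemma subgradient:
  assumes "0 \<le> x"
  obtains p where "0 \<le> p" "\<And>s. 0 \<le> s \<Longrightarrow> M x + p * (s - x) \<le> M s"
proof (cases "x = 0")
  case True
  then show ?thesis
    using that[of 0] M_nonneg by simp
next
  case False
  \<comment> \<open>The infimum of the secant slopes to the right of \<open>x\<close>, that is, the
    right derivative. It requires an interior point of the half-line, hence the separate case
    \<open>x = 0\<close>.\<close>
  define p where "p = Inf ((\<lambda>t. (M x - M t) / (x - t)) ` ({x<..} \<inter> {0..}))"
  have p: "M x + p * (s - x) \<le> M s" if "0 \<le> s" for s
    unfolding p_def
    using convex_le_Inf_differential[OF convex_M, of x s] assms False that by simp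
  \<comment> \<open>The subgradient inequality at \<open>s = 0\<close> gives
    \<open>M x \<le> p * x\<close>.\<close>
  have "0 \<le> p * x"
    using p[of 0] M_nonneg[OF assms] by simp
  then have "0 \<le> p"
    using assms False by (simp add: zero_le_mult_iff)
  then show ?thesis
    using p that by blast
qed

text \<open>A series of nonnegative terms is the supremum of its finite sums. Later arguments work
  with finite sections and so avoid extended reals.\<close>

lemma orlicz_radii_iff:
  "t \<in> orlicz_radii M f \<longleftrightarrow> 0 < t \<and> (\<forall>F. finite F \<longrightarrow> (\<Sum>j\<in>F. M (norm (f j) / t)) \<le> 1)"
proof (cases "t > 0")
  case True
  have sum: "(\<Sum>j\<in>F. ennreal (M (norm (f j) / t))) = ennreal (\<Sum>j\<in>F. M (norm (f j) / t))" for F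
    using True by (intro sum_ennreal) (auto intro: M_nonneg)
  have "(\<Sum>n. ennreal (M (norm (f n) / t))) \<le> 1 \<longleftrightarrow>
      (\<forall>F. finite F \<longrightarrow> (\<Sum>j\<in>F. M (norm (f j) / t)) \<le> 1)"
  proof safe
    fix F :: "nat set"
    assume "(\<Sum>n. ennreal (M (norm (f n) / t))) \<le> 1" "finite F"
    then have "(\<Sum>j\<in>F. ennreal (M (norm (f j) / t))) \<le> 1"
      using sum_le_suminf[of "\<lambda>n. ennreal (M (norm (f n) / t))" F] by (auto intro: order_trans)
    then show "(\<Sum>j\<in>F. M (norm (f j) / t)) \<le> 1"
      unfolding sum by simp
  next
    assume "\<forall>F. finite F \<longrightarrow> (\<Sum>j\<in>F. M (norm (f j) / t)) \<le> 1"
    then have "(\<Sum>j<n. ennreal (M (norm (f j) / t))) \<le> 1" for n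
      unfolding sum by simp
    then show "(\<Sum>n. ennreal (M (norm (f n) / t))) \<le> 1"
      unfolding suminf_eq_SUP by (intro SUP_least) auto
  qed
  with True show ?thesis
    by (simp add: orlicz_radii_def)
qed (auto simp: orlicz_radii_def)

lemma orlicz_radii_dominated:
  assumes "t \<in> orlicz_radii M f" "t \<le> s" "\<And>j. norm (g j) \<le> norm (f j)"
  shows "s \<in> orlicz_radii M g"
proof -
  have t: "0 < t" using assms by (simp add: orlicz_radii_iff)
  have "(\<Sum>j\<in>F. M (norm (g j) / s)) \<le> (\<Sum>j\<in>F. M (norm (f j) / t))" for F
    using assms t by (intro sum_mono M_mono frac_le) auto
  then show ?thesis
    using assms t unfolding orlicz_radii_iff by (meson order_trans less_le_trans)
qed

lemma norm_le_orlicz_radius: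
  assumes "t \<in> orlicz_radii M f"
  shows "norm (f j) \<le> t"
proof -
  have t: "0 < t" and "M (norm (f j) / t) \<le> 1"
    using assms by (auto simp: orlicz_radii_iff dest!: spec[of _ "{j}"])
  then have "norm (f j) / t \<le> 1"
    using le_1_if_M_le_1[of "norm (f j) / t"] by simp
  then show ?thesis
    using t by simp
qed

lemma orlicz_radii_add:
  assumes "s \<in> orlicz_radii M f" "t \<in> orlicz_radii M g"
  shows "s + t \<in> orlicz_radii M (f + g)"
proof -
  have s: "0 < s" and t: "0 < t" using assms by (auto simp: orlicz_radii_iff)
  \<comment> \<open>The weights \<open>s / (s + t)\<close> and \<open>t / (s + t)\<close> turn the
    scaled sum into a convex combination of the two scaled sequences.\<close>
  define l where "l = t / (s + t)"
  have l: "0 \<le> l" "l \<le> 1" and l': "1 - l = s / (s + t)"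
    using s t by (auto simp: l_def field_simps)
  have "M (norm ((f + g) j) / (s + t)) \<le> (1 - l) * M (norm (f j) / s) + l * M (norm (g j) / t)" for j
  proof -
    have "norm ((f + g) j) / (s + t) \<le> (norm (f j) + norm (g j)) / (s + t)"
      using s t by (intro divide_right_mono) (auto intro: norm_triangle_ineq)
    also have "\<dots> = (1 - l) * (norm (f j) / s) + l * (norm (g j) / t)"
      unfolding l' unfolding l_def using s t by (simp add: add_divide_distrib)
    finally have "M (norm ((f + g) j) / (s + t)) \<le> M ((1 - l) * (norm (f j) / s) + l * (norm (g j) / t))"
      using s t by (intro M_mono) auto
    also have "\<dots> \<le> (1 - l) * M (norm (f j) / s) + l * M (norm (g j) / t)"
      using convex_onD[OF convex_M l, of "norm (f j) / s" "norm (g j) / t"] s t by simp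
    finally show ?thesis .
  qed
  then have "(\<Sum>j\<in>F. M (norm ((f + g) j) / (s + t)))
      \<le> (1 - l) * (\<Sum>j\<in>F. M (norm (f j) / s)) + l * (\<Sum>j\<in>F. M (norm (g j) / t))" for F
    by (simp add: sum_distrib_left sum.distrib[symmetric] sum_mono)
  also have "\<dots> F \<le> (1 - l) * 1 + l * 1" if "finite F" for F
    using l assms that by (intro add_mono mult_left_mono) (auto simp: orlicz_radii_iff)
  finally show ?thesis
    using s t by (simp add: orlicz_radii_iff)
qed

lemma orlicz_radii_scale:
  assumes "t \<in> orlicz_radii M f" "c \<noteq> 0"
  shows "norm c * t \<in> orlicz_radii M (fscale c f)"
  using assms by (simp add: orlicz_radii_iff fscale_def norm_mult)

lemma orlicz_radii_0: "orlicz_radii M 0 = {0<..}"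
  by (auto simp: orlicz_radii_iff)

lemma orlicz_space_simps:
  "smul (orlicz_space M) = fscale"
  "f \<in> vecs (orlicz_space M) \<longleftrightarrow> orlicz_radii M f \<noteq> {}"
  "nrm (orlicz_space M) f = Inf (orlicz_radii M f)"
  by (simp_all add: orlicz_space_def)

lemma orlicz_norm_le: "t \<in> orlicz_radii M f \<Longrightarrow> nrm (orlicz_space M) f \<le> t"
  unfolding orlicz_space_simps
  by (erule cInf_lower) (rule bdd_belowI[of _ 0], simp add: orlicz_radii_def)

lemma orlicz_norm_ge:
  assumes "f \<in> vecs (orlicz_space M)" "\<And>t. t \<in> orlicz_radii M f \<Longrightarrow> a \<le> t"
  shows "a \<le> nrm (orlicz_space M) f"
  using assms unfolding orlicz_space_simps by (intro cInf_greatest) auto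

text \<open>The closure properties of the admissible radii pass to their infimum. Definiteness holds
  because every coordinate is bounded by every admissible radius.\<close>

lemma norm_space_orlicz: "norm_space (orlicz_space M :: ('k::real_normed_field, nat \<Rightarrow> 'k) nspace)"
proof -
  let ?L = "orlicz_space M :: ('k, nat \<Rightarrow> 'k) nspace"
  interpret module "smul ?L"
    by (simp add: orlicz_space_simps module_fscale)
  have scale: "fscale c f \<in> vecs ?L" if "f \<in> vecs ?L" for c f
  proof (cases "c = 0")
    case True
    then have "fscale c f = 0" by (auto simp: fscale_def)
    then show ?thesis by (simp add: orlicz_space_simps orlicz_radii_0)
  next
    case False
    then show ?thesis
      using that orlicz_radii_scale unfolding orlicz_space_simps by blast
  qed
  have scale_le: "nrm ?L (fscale c f) \<le> norm c * nrm ?L f" if "f \<in> vecs ?L" "c \<noteq> 0" for c f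
  proof -
    have "nrm ?L (fscale c f) / norm c \<le> nrm ?L f"
    proof (rule orlicz_norm_ge[OF that(1)])
      fix t assume "t \<in> orlicz_radii M f"
      then show "nrm ?L (fscale c f) / norm c \<le> t"
        using orlicz_norm_le[OF orlicz_radii_scale[OF _ that(2)]] that(2)
        by (simp add: field_simps)
    qed
    then show ?thesis
      using that(2) by (simp add: field_simps)
  qed
  show ?thesis
  proof
    show "subspace (vecs ?L)"
    proof (rule subspaceI)
      show "0 \<in> vecs ?L"
        by (simp add: orlicz_space_simps orlicz_radii_0)
    next
      fix f g assume "f \<in> vecs ?L" "g \<in> vecs ?L"
      then show "f + g \<in> vecs ?L"
        unfolding orlicz_space_simps using orlicz_radii_add by blast
    qed (simp add: orlicz_space_simps(1) scale)
  next
    fix f assume f: "f \<in> vecs ?L" "nrm ?L f = 0"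
    have "norm (f j) \<le> nrm ?L f" for j
      using f(1) by (rule orlicz_norm_ge) (rule norm_le_orlicz_radius)
    then show "f = 0"
      using f(2) by auto
  next
    fix f c assume f: "f \<in> vecs ?L"
    show "nrm ?L (smul ?L c f) = norm c * nrm ?L f"
    proof (cases "c = 0")
      case True
      then have "fscale c f = 0" by (auto simp: fscale_def)
      then show ?thesis
        using True by (simp add: orlicz_space_simps orlicz_radii_0)
    next
      case False
      have "nrm ?L (fscale (inverse c) (fscale c f)) \<le> norm (inverse c) * nrm ?L (fscale c f)"
        using False by (intro scale_le scale f) auto
      moreover have "fscale (inverse c) (fscale c f) = f"
        using False by (simp add: fscale_def fun_eq_iff)
      ultimately have "norm c * nrm ?L f \<le> nrm ?L (fscale c f)"
        using False by (simp add: norm_inverse norm_divide field_simps)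
      then show ?thesis
        using scale_le[OF f False] by (simp add: orlicz_space_simps(1))
    qed
  next
    fix f g assume fg: "f \<in> vecs ?L" "g \<in> vecs ?L"
    have "nrm ?L (f + g) - s \<le> nrm ?L g" if "s \<in> orlicz_radii M f" for s
      using fg(2)
    proof (rule orlicz_norm_ge)
      fix t assume "t \<in> orlicz_radii M g"
      then show "nrm ?L (f + g) - s \<le> t"
        using orlicz_norm_le[OF orlicz_radii_add[OF that, of t g]] by simp
    qed
    then have "nrm ?L (f + g) - nrm ?L g \<le> nrm ?L f"
      by (intro orlicz_norm_ge fg) (simp add: algebra_simps)
    then show "nrm ?L (f + g) \<le> nrm ?L f + nrm ?L g"
      by simp
  qed
qed

end

section \<open>The functionals on the span of the coordinate functionals\<close>

definition chop :: "nat set \<Rightarrow> (nat \<Rightarrow> 'k) \<Rightarrow> nat \<Rightarrow> 'k::zero" where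
  "chop A f = (\<lambda>i. if i \<in> A then f i else 0)"

lemma sum_scale_unit_vector:
  fixes w :: "nat \<Rightarrow> 'k::real_normed_field"
  assumes "finite F"
  shows "(\<Sum>j\<in>F. fscale (w j) (unit_vector j)) = chop F w"
proof
  fix i
  have "(\<Sum>j\<in>F. fscale (w j) (unit_vector j)) i = (\<Sum>j\<in>F. w j * (if i = j then 1 else 0))"
    by (induction F rule: infinite_finite_induct) (auto simp: fscale_def unit_vector_def)
  then show "(\<Sum>j\<in>F. fscale (w j) (unit_vector j)) i = chop F w i"
    using assms by (simp add: chop_def if_distrib cong: if_cong)
qed

text \<open>The parameter of type \<open>itself\<close> pins down the scalar field, so that the real
  and the complex case are two interpretations of one development.\<close>

locale orlicz_sequence = orlicz_function M for M +
  fixes scalars :: "'k::real_normed_field itself"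
begin

abbreviation L :: "('k, nat \<Rightarrow> 'k) nspace" where
  "L \<equiv> orlicz_space M"

abbreviation e :: "nat \<Rightarrow> nat \<Rightarrow> 'k" where
  "e \<equiv> unit_vector"

definition Y :: "('k, nat \<Rightarrow> 'k) nspace" where
  "Y = closed_span L e"

text \<open>The value 0 outside \<open>Y\<close> follows the convention of
  \<open>bounded_functional\<close>; it makes \<open>ev j\<close> equal to the coordinate functional
  as a total function.\<close>

definition ev :: "nat \<Rightarrow> (nat \<Rightarrow> 'k) \<Rightarrow> 'k" where
  "ev j y = (if y \<in> vecs Y then y j else 0)"

definition X :: "('k, (nat \<Rightarrow> 'k) \<Rightarrow> 'k) nspace" where
  "X = closed_span (dual Y) ev"

sublocale L: norm_space L
  by (rule norm_space_orlicz)

lemma one_radius_e: "1 \<in> orlicz_radii M (e k)"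
proof -
  have "(\<Sum>j\<in>F. M (norm (e k j) / 1)) = (\<Sum>j\<in>F. if j = k then 1 else 0)" for F
    by (intro sum.cong) (auto simp: unit_vector_def)
  then show ?thesis
    by (simp add: orlicz_radii_iff)
qed

lemma e_in_L: "e k \<in> vecs L"
  using one_radius_e by (auto simp: orlicz_space_simps)

sublocale Y: norm_space Y
  unfolding Y_def by (rule L.norm_space_closed_span) (rule e_in_L)

sublocale Y': norm_space "dual Y"
  by (rule Y.norm_space_dual)

lemma Y_simps [simp]: "smul Y = fscale" "nrm Y = nrm L"
  by (simp_all add: Y_def orlicz_space_simps)

lemma e_in_Y: "e k \<in> vecs Y"
  unfolding Y_def by (rule L.base_in_closed_span) (rule e_in_L)

lemma Y_subset_L: "vecs Y \<subseteq> vecs L"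
  unfolding Y_def by (rule L.vecs_closed_span_subset) (rule e_in_L)

lemma dual_simps [simp]:
  "\<phi> \<in> vecs (dual E) \<longleftrightarrow> bounded_functional E \<phi>" "smul (dual E) = fscale"
  by (simp_all add: dual_def)

lemma chop_in_L: "y \<in> vecs L \<Longrightarrow> chop A y \<in> vecs L"
  and nrm_chop_le: "y \<in> vecs L \<Longrightarrow> nrm L (chop A y) \<le> nrm L y"
proof -
  have *: "t \<in> orlicz_radii M (chop A y)" if "t \<in> orlicz_radii M y" for t and y :: "nat \<Rightarrow> 'k"
    using that by (rule orlicz_radii_dominated) (auto simp: chop_def)
  show "y \<in> vecs L \<Longrightarrow> chop A y \<in> vecs L"
    using * by (auto simp: orlicz_space_simps)
  show "y \<in> vecs L \<Longrightarrow> nrm L (chop A y) \<le> nrm L y"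
    by (rule orlicz_norm_ge) (auto intro: * orlicz_norm_le)
qed

lemma chop_add: "chop A (y + z) = chop A y + chop A (z :: nat \<Rightarrow> 'k)"
  and chop_diff: "chop A (y - z) = chop A y - chop A (z :: nat \<Rightarrow> 'k)"
  and chop_scale: "chop A (fscale c y) = fscale c (chop A y)"
  and chop_Int: "chop A (chop B y) = chop (A \<inter> B) y"
  by (auto simp: chop_def fscale_def)

lemma finite_support_in_span: "finite F \<Longrightarrow> chop F w \<in> L.span (range e)"
  unfolding sum_scale_unit_vector[symmetric]
  by (intro L.span_sum) (metis L.span_base L.span_scale orlicz_space_simps(1) rangeI)

lemma finite_support_in_Y: "finite F \<Longrightarrow> chop F w \<in> vecs Y"
  using finite_support_in_span L.span_subset_closed_span[of e] e_in_L by (auto simp: Y_def)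

text \<open>Restriction to \<open>A\<close> is a contraction and keeps finitely supported sequences
  finitely supported, so it preserves their closure.\<close>

lemma chop_in_Y:
  assumes "y \<in> vecs Y"
  shows "chop A y \<in> vecs Y"
proof -
  have Y: "vecs Y = {v \<in> vecs L. \<forall>\<epsilon>>0. \<exists>u\<in>L.span (range e). nrm L (v - u) < \<epsilon>}"
    unfolding Y_def by (rule L.vecs_closed_span) (rule e_in_L)
  have yL: "y \<in> vecs L"
    using assms Y_subset_L by blast
  have "\<exists>u\<in>L.span (range e). nrm L (chop A y - u) < \<epsilon>" if "\<epsilon> > 0" for \<epsilon>
  proof -
    obtain u where u: "u \<in> L.span (range e)" "nrm L (y - u) < \<epsilon>"
      using assms \<open>\<epsilon> > 0\<close> unfolding Y by blast
    obtain F :: "nat set" and c where F: "finite F" "u = chop F c"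
      using L.span_range_explicit[OF u(1)] sum_scale_unit_vector by (metis orlicz_space_simps(1))
    have uL: "u \<in> vecs L"
      using u(1) L.span_subset_vecs[of e] e_in_L by blast
    have "chop A u \<in> L.span (range e)"
      unfolding F(2) chop_Int using F(1) by (intro finite_support_in_span) simp
    moreover have "nrm L (chop A y - chop A u) \<le> nrm L (y - u)"
      unfolding chop_diff[symmetric] using L.subspace_diff[OF L.subspace_vecs yL uL]
      by (rule nrm_chop_le)
    ultimately show ?thesis
      using u(2) by (meson le_less_trans)
  qed
  then show ?thesis
    unfolding Y using chop_in_L[OF yL] by blast
qed

lemma ev_bounded: "bounded_functional Y (ev j)"
proof -
  have "norm (y j) \<le> nrm L y" if "y \<in> vecs Y" for y
    using that Y_subset_L by (intro orlicz_norm_ge norm_le_orlicz_radius) auto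
  then have "\<exists>C. \<forall>y\<in>vecs Y. norm (ev j y) \<le> C * nrm Y y"
    by (intro exI[of _ 1]) (auto simp: ev_def)
  moreover have "fscale c y \<in> vecs Y" if "y \<in> vecs Y" for c y
    using Y.subspace_scale[OF Y.subspace_vecs that] by simp
  ultimately show ?thesis
    using Y.subspace_add[OF Y.subspace_vecs]
    by (auto simp: bounded_functional_def ev_def fscale_def)
qed

lemma ev_e: "ev j (e k) = (if k = j then 1 else 0)"
  using e_in_Y by (auto simp: ev_def unit_vector_def)

lemma coord_Y: "coord Y e = ev"
  unfolding Y_def
  by (intro ext L.coord_closed_span_eqI[THEN fun_cong] e_in_L)
     (use ev_bounded ev_e in \<open>auto simp: Y_def\<close>)

lemma lechner_condition_iff: "lechner_condition L e \<longleftrightarrow> dual_basis_lechner X ev"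
  by (simp add: lechner_condition_def Let_def coord_Y X_def flip: Y_def)

sublocale X: norm_space X
  unfolding X_def by (rule Y'.norm_space_closed_span) (simp add: ev_bounded)

sublocale X': norm_space "dual X"
  by (rule X.norm_space_dual)

lemma X_simps [simp]: "smul X = fscale" "nrm X = nrm (dual Y)"
  by (simp_all add: X_def)

lemma ev_in_X: "ev j \<in> vecs X"
  unfolding X_def by (rule Y'.base_in_closed_span) (simp add: ev_bounded)

lemma X_bounded: "\<phi> \<in> vecs X \<Longrightarrow> bounded_functional Y \<phi>"
  using Y'.vecs_closed_span_subset[of ev] ev_bounded unfolding X_def by auto

section \<open>Functionals on \<open>X\<close> and the Orlicz modular\<close>

lemma span_ev_explicit:
  assumes "u \<in> Y'.span (range ev)"
  obtains F :: "nat set" and c where "finite F" "u = (\<Sum>j\<in>F. fscale (c j) (ev j))"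
  using Y'.span_range_explicit[OF assms] by (metis dual_simps(2))

lemma sum_ev_in_X: "(\<Sum>j\<in>F. fscale (c j) (ev j)) \<in> vecs X"
  by (intro X.subspace_sum[OF X.subspace_vecs])
     (metis X.subspace_scale X.subspace_vecs X_simps(1) ev_in_X)

lemma sum_ev_apply: "y \<in> vecs Y \<Longrightarrow> (\<Sum>j\<in>F. fscale (c j) (ev j)) y = (\<Sum>j\<in>F. c j * y j)"
  by (induction F rule: infinite_finite_induct) (auto simp: fscale_def ev_def)

text \<open>
  The functional \<open>\<phi>\<close> in the proof is an explicit substitute for a norming functional of the
  Hahn--Banach theorem: its coefficients are subgradients of \<open>M\<close> at the moduli of the sequence.
\<close>

lemma modular_le_of_functional:
  assumes f: "bounded_functional X f" and le: "nrm (dual X) f \<le> r" and "0 < r" and F: "finite F"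
  shows "(\<Sum>j\<in>F. M (norm (f (ev j)) / r)) \<le> 1"
proof (rule ccontr)
  define w where "w j = norm (f (ev j)) / r" for j
  define S where "S = (\<Sum>j\<in>F. M (w j))"
  assume "\<not> (\<Sum>j\<in>F. M (norm (f (ev j)) / r)) \<le> 1"
  then have S: "S > 1"
    by (simp add: S_def w_def)
  have w: "0 \<le> w j" for j
    using \<open>0 < r\<close> by (simp add: w_def)
  have "\<exists>p\<ge>0. \<forall>s\<ge>0. M (w j) + p * (s - w j) \<le> M s" for j
    using subgradient[OF w, of j] by metis
  then obtain p where p: "\<And>j. 0 \<le> p j"
      and p_le: "\<And>j s. 0 \<le> s \<Longrightarrow> M (w j) + p j * (s - w j) \<le> M s"
    by metis
  \<comment> \<open>In terms of the convex conjugate of \<open>M\<close>, the quantity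
    \<open>D - S\<close> is the conjugate modular of the subgradients \<open>p\<close>. This is why
    \<open>D - S + 1\<close> will bound the norm of the test functional.\<close>
  define D where "D = (\<Sum>j\<in>F. p j * w j)"
  have "S \<le> D"
    unfolding S_def D_def
  proof (rule sum_mono)
    fix j
    show "M (w j) \<le> p j * w j"
      using p_le[of 0 j] by simp
  qed
  then have pos: "0 < D - S + 1" by simp
  \<comment> \<open>A subgradient times the phase that makes \<open>c j * f (ev j)\<close>
    nonnegative. Where \<open>f (ev j)\<close> is 0 the quotient is 0, so the modulus of
    \<open>c j\<close> is only bounded by \<open>p j\<close>.\<close>
  define c where "c j = of_real (p j) * (of_real (norm (f (ev j))) / f (ev j))" for j
  have norm_c: "norm (c j) \<le> p j" for j
    using p[of j] by (simp add: c_def norm_mult norm_divide)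
  define \<phi> where "\<phi> = (\<Sum>j\<in>F. fscale (c j) (ev j))"
  have "nrm (dual Y) \<phi> \<le> D - S + 1"
  proof (rule Y.nrm_dual_le')
    fix y assume y: "y \<in> vecs Y"
    then have yL: "y \<in> vecs L"
      using Y_subset_L by blast
    have "norm (\<phi> y) / (D - S + 1) \<le> nrm L y"
    proof (rule orlicz_norm_ge[OF yL])
      fix t assume t: "t \<in> orlicz_radii M y"
      then have "0 < t" and mod: "(\<Sum>j\<in>F. M (norm (y j) / t)) \<le> 1"
        using F by (auto simp: orlicz_radii_iff)
      have "norm (\<phi> y) \<le> (\<Sum>j\<in>F. norm (c j * y j))"
        unfolding \<phi>_def sum_ev_apply[OF y] by (rule norm_sum)
      also have "\<dots> \<le> (\<Sum>j\<in>F. t * (p j * (norm (y j) / t)))"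
        using norm_c \<open>0 < t\<close> by (intro sum_mono) (auto simp: norm_mult intro: mult_right_mono)
      \<comment> \<open>Young's inequality, in the form given by the subgradient.\<close>
      also have "\<dots> \<le> (\<Sum>j\<in>F. t * (M (norm (y j) / t) - M (w j) + p j * w j))"
      proof (intro sum_mono mult_left_mono)
        fix j
        show "p j * (norm (y j) / t) \<le> M (norm (y j) / t) - M (w j) + p j * w j"
          using p_le[of "norm (y j) / t" j] \<open>0 < t\<close> by (simp add: right_diff_distrib)
      qed (use \<open>0 < t\<close> in simp)
      also have "\<dots> = t * ((\<Sum>j\<in>F. M (norm (y j) / t)) - S + D)"
        by (simp add: S_def D_def sum_distrib_left[symmetric] sum.distrib sum_subtractf)
      also have "\<dots> \<le> t * (D - S + 1)"
        using mod \<open>0 < t\<close> by (intro mult_left_mono) auto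
      finally show "norm (\<phi> y) / (D - S + 1) \<le> t"
        using pos by (simp add: divide_le_eq)
    qed
    then show "norm (\<phi> y) \<le> (D - S + 1) * nrm Y y"
      using pos by (simp add: divide_le_eq mult.commute)
  qed (use pos in simp)
  moreover have "norm (f \<phi>) = r * D"
  proof -
    have "f \<phi> = (\<Sum>j\<in>F. c j * f (ev j))"
      using X.bounded_functional_sum[OF f, of F ev c] ev_in_X by (simp add: \<phi>_def)
    also have "\<dots> = (\<Sum>j\<in>F. of_real (r * (p j * w j)))"
      using \<open>0 < r\<close> by (intro sum.cong) (auto simp: c_def w_def)
    also have "\<dots> = of_real (r * D)"
      by (simp add: D_def sum_distrib_left)
    finally show ?thesis
      using \<open>S \<le> D\<close> S \<open>0 < r\<close> by (simp add: norm_mult)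
  qed
  moreover have "norm (f \<phi>) \<le> nrm (dual X) f * nrm (dual Y) \<phi>"
    using X.norm_le_nrm_dual[OF f, of \<phi>] sum_ev_in_X by (simp add: \<phi>_def)
  moreover have "0 \<le> nrm (dual Y) \<phi>"
    using X.nrm_ge_0[of \<phi>] sum_ev_in_X by (simp add: \<phi>_def)
  \<comment> \<open>The test functional attains \<open>r * D\<close>, while its norm allows at most
    \<open>r * (D - S + 1)\<close>; together they contradict \<open>S > 1\<close>.\<close>
  ultimately have "r * D \<le> r * (D - S + 1)"
    using le \<open>0 < r\<close> by (smt (verit) mult_mono)
  then show False
    using \<open>0 < r\<close> S by simp
qed

text \<open>On a finite combination \<open>u\<close> of the \<open>ev j\<close>, the functional
  \<open>s\<close> acts as evaluation of \<open>u\<close> at the finite section \<open>w\<close> of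
  the sequence of its values. The modular bound says that \<open>w\<close> has norm at most
  \<open>r\<close>, and density extends the estimate to \<open>X\<close>.\<close>

lemma functional_norm_le:
  assumes s: "bounded_functional X s" and "0 < r"
    and le: "\<And>F. finite F \<Longrightarrow> (\<Sum>j\<in>F. M (norm (s (ev j)) / r)) \<le> 1"
  shows "nrm (dual X) s \<le> r"
proof (rule X.nrm_dual_le')
  fix \<phi> assume \<phi>: "\<phi> \<in> vecs X"
  have "norm (s \<phi>) \<le> r * nrm (dual Y) \<phi>"
  proof (rule Y'.bounded_functional_closed_span_le[of ev])
    fix u assume u: "u \<in> Y'.span (range ev)"
    then obtain F and c :: "nat \<Rightarrow> 'k" where F: "finite F" "u = (\<Sum>j\<in>F. fscale (c j) (ev j))"
      by (rule span_ev_explicit)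
    define w where "w = chop F (\<lambda>j. s (ev j))"
    have wY: "w \<in> vecs Y"
      unfolding w_def by (rule finite_support_in_Y[OF F(1)])
    have "r \<in> orlicz_radii M w"
      unfolding orlicz_radii_iff
    proof (intro conjI allI impI)
      fix G :: "nat set" assume G: "finite G"
      have "(\<Sum>j\<in>G. M (norm (w j) / r)) \<le> (\<Sum>j\<in>G. M (norm (s (ev j)) / r))"
        using \<open>0 < r\<close> by (intro sum_mono M_mono) (auto simp: w_def chop_def)
      then show "(\<Sum>j\<in>G. M (norm (w j) / r)) \<le> 1"
        using le[OF G] by simp
    qed fact
    then have "nrm Y w \<le> r"
      by (simp add: orlicz_norm_le)
    have "u \<in> vecs X"
      unfolding F by (rule sum_ev_in_X)
    then have ub: "bounded_functional Y u"
      by (rule X_bounded)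
    have "s u = u w"
      using X.bounded_functional_sum[OF s, of F ev c] ev_in_X
      by (simp add: F sum_ev_apply[OF wY]) (simp add: w_def chop_def)
    then have "norm (s u) \<le> nrm (dual Y) u * nrm Y w"
      using Y.norm_le_nrm_dual[OF ub wY] by simp
    also have "\<dots> \<le> nrm (dual Y) u * r"
      using \<open>nrm Y w \<le> r\<close> Y'.nrm_ge_0[of u] ub by (intro mult_left_mono) auto
    finally show "norm (s u) \<le> r * nrm (dual Y) u"
      by (simp add: mult.commute)
  qed (use s \<phi> \<open>0 < r\<close> ev_bounded in \<open>auto simp: X_def\<close>)
  then show "norm (s \<phi>) \<le> r * nrm X \<phi>"
    by simp
qed (use \<open>0 < r\<close> in simp)

section \<open>Coordinate projections on \<open>X\<close> as adjoints of \<open>chop\<close>\<close>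

definition proj :: "nat set \<Rightarrow> ((nat \<Rightarrow> 'k) \<Rightarrow> 'k) \<Rightarrow> (nat \<Rightarrow> 'k) \<Rightarrow> 'k" where
  "proj A \<phi> y = (if y \<in> vecs Y then \<phi> (chop A y) else 0)"

lemma norm_proj_le:
  assumes \<phi>: "bounded_functional Y \<phi>" and y: "y \<in> vecs Y"
  shows "norm (proj A \<phi> y) \<le> nrm (dual Y) \<phi> * nrm Y y"
proof -
  have "norm (proj A \<phi> y) \<le> nrm (dual Y) \<phi> * nrm Y (chop A y)"
    using Y.norm_le_nrm_dual[OF \<phi> chop_in_Y[OF y]] y by (simp add: proj_def)
  also have "\<dots> \<le> nrm (dual Y) \<phi> * nrm Y y"
    using nrm_chop_le[of y A] y Y_subset_L Y'.nrm_ge_0[of \<phi>] \<phi> by (intro mult_left_mono) auto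
  finally show ?thesis .
qed

lemma proj_bounded:
  assumes \<phi>: "bounded_functional Y \<phi>"
  shows "bounded_functional Y (proj A \<phi>)"
  unfolding bounded_functional_def
proof (intro conjI ballI allI impI)
  fix y z assume "y \<in> vecs Y" "z \<in> vecs Y"
  then show "proj A \<phi> (y + z) = proj A \<phi> y + proj A \<phi> z"
    using \<phi> Y.subspace_add[OF Y.subspace_vecs]
    by (simp add: proj_def chop_add Y.bounded_functional_add chop_in_Y)
next
  fix c y assume "y \<in> vecs Y"
  then show "proj A \<phi> (smul Y c y) = c * proj A \<phi> y"
    using Y.bounded_functional_smul[OF \<phi>, of "chop A y" c] Y.subspace_scale[OF Y.subspace_vecs, of y c]
    by (simp add: proj_def chop_scale chop_in_Y)
next
  show "\<exists>C. \<forall>y\<in>vecs Y. norm (proj A \<phi> y) \<le> C * nrm Y y"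
    using norm_proj_le[OF \<phi>] by blast
qed (simp add: proj_def)

lemma nrm_proj_le:
  assumes "bounded_functional Y \<phi>"
  shows "nrm (dual Y) (proj A \<phi>) \<le> nrm (dual Y) \<phi>"
  using assms Y'.nrm_ge_0[of \<phi>] by (intro Y.nrm_dual_le' norm_proj_le) auto

lemma proj_add: "proj A (\<phi> + \<psi>) = proj A \<phi> + proj A \<psi>"
  and proj_diff: "proj A (\<phi> - \<psi>) = proj A \<phi> - proj A \<psi>"
  and proj_scale: "proj A (fscale c \<phi>) = fscale c (proj A \<phi>)"
  and proj_0: "proj A 0 = 0"
  by (auto simp: proj_def fscale_def)

lemma proj_sum: "proj A (sum u F) = (\<Sum>j\<in>F. proj A (u j))"
  by (induction F rule: infinite_finite_induct) (simp_all only: sum.infinite sum.empty sum.insert proj_add proj_0 not_False_eq_True)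

lemma proj_ev: "proj A (ev j) = (if j \<in> A then ev j else 0)"
  by (auto simp: proj_def ev_def chop_def chop_in_Y[unfolded chop_def])

lemma proj_sum_ev:
  "proj A (\<Sum>j\<in>F. fscale (c j) (ev j)) = (\<Sum>j\<in>F. fscale (if j \<in> A then c j else 0) (ev j))"
  unfolding proj_sum proj_scale proj_ev
  by (intro sum.cong) (auto simp: fscale_def)

text \<open>Applying the functional to the expansion of a finite section identifies the partial sums
  of the coordinate expansion with projections, whose norms are under control.\<close>

lemma proj_finite:
  assumes \<phi>: "bounded_functional Y \<phi>" and "finite F"
  shows "proj F \<phi> = (\<Sum>j\<in>F. fscale (\<phi> (e j)) (ev j))"
proof
  fix y
  show "proj F \<phi> y = (\<Sum>j\<in>F. fscale (\<phi> (e j)) (ev j)) y"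
  proof (cases "y \<in> vecs Y")
    case True
    have "\<phi> (chop F y) = (\<Sum>j\<in>F. y j * \<phi> (e j))"
      using Y.bounded_functional_sum[OF \<phi>, of F e y] e_in_Y
      by (simp add: sum_scale_unit_vector[OF \<open>finite F\<close>])
    with True show ?thesis
      by (simp add: proj_def sum_ev_apply mult.commute)
  next
    case False
    then show ?thesis
      using X_bounded[OF sum_ev_in_X[of "\<lambda>j. \<phi> (e j)" F]]
      by (simp add: proj_def bounded_functional_def)
  qed
qed

lemma X_approx:
  assumes "\<phi> \<in> vecs X" "0 < \<epsilon>"
  obtains F :: "nat set" and c where "finite F"
    "nrm (dual Y) (\<phi> - (\<Sum>j\<in>F. fscale (c j) (ev j))) < \<epsilon>"
proof -
  have "\<exists>u\<in>Y'.span (range ev). nrm (dual Y) (\<phi> - u) < \<epsilon>"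
    using assms Y'.vecs_closed_span[of ev] ev_bounded by (auto simp: X_def)
  then show ?thesis
    using that by (metis span_ev_explicit)
qed

text \<open>The projection is a contraction on the dual of \<open>Y\<close> and maps the span of the
  \<open>ev j\<close> into itself.\<close>

lemma proj_in_X:
  assumes \<phi>: "\<phi> \<in> vecs X"
  shows "proj A \<phi> \<in> vecs X"
proof -
  have "\<exists>u\<in>Y'.span (range ev). nrm (dual Y) (proj A \<phi> - u) < \<epsilon>" if \<epsilon>: "0 < \<epsilon>" for \<epsilon>
  proof -
    obtain F :: "nat set" and c where
      F: "finite F" "nrm (dual Y) (\<phi> - (\<Sum>j\<in>F. fscale (c j) (ev j))) < \<epsilon>"
      using X_approx[OF \<phi> \<epsilon>] .
    let ?u = "\<Sum>j\<in>F. fscale (c j) (ev j)"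
    have "bounded_functional Y (\<phi> - ?u)"
      using X.subspace_diff[OF X.subspace_vecs \<phi> sum_ev_in_X] by (rule X_bounded)
    then have "nrm (dual Y) (proj A \<phi> - proj A ?u) < \<epsilon>"
      using nrm_proj_le[of "\<phi> - ?u" A] F(2) by (simp add: proj_diff)
    moreover have "proj A ?u \<in> Y'.span (range ev)"
      unfolding proj_sum_ev
      by (intro Y'.span_sum) (metis Y'.span_base Y'.span_scale dual_simps(2) rangeI)
    ultimately show ?thesis by blast
  qed
  then show ?thesis
    using proj_bounded[OF X_bounded[OF \<phi>]] Y'.vecs_closed_span[of ev] ev_bounded
    by (simp add: X_def)
qed

text \<open>Evaluation at \<open>e j\<close> is bounded on \<open>X\<close> and biorthogonal to
  \<open>ev\<close>, so it is the coordinate functional.\<close>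

lemma coord_X:
  assumes "\<phi> \<in> vecs X"
  shows "coord X ev j \<phi> = \<phi> (e j)"
proof -
  define \<delta> where "\<delta> \<psi> = (if \<psi> \<in> vecs X then \<psi> (e j) else 0)" for \<psi>
  have "norm (\<psi> (e j)) \<le> nrm Y (e j) * nrm X \<psi>" if "\<psi> \<in> vecs X" for \<psi>
    using Y.norm_le_nrm_dual[OF X_bounded[OF that] e_in_Y, of j] by (simp add: mult.commute)
  then have "\<exists>C. \<forall>\<psi>\<in>vecs X. norm (\<delta> \<psi>) \<le> C * nrm X \<psi>"
    by (intro exI[of _ "nrm Y (e j)"]) (auto simp: \<delta>_def)
  moreover have "fscale c \<psi> \<in> vecs X" if "\<psi> \<in> vecs X" for c \<psi>
    using X.subspace_scale[OF X.subspace_vecs that] by simp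
  ultimately have "bounded_functional X \<delta>"
    using X.subspace_add[OF X.subspace_vecs]
    by (auto simp: bounded_functional_def \<delta>_def fscale_def)
  then have "coord X ev j = \<delta>"
    unfolding X_def
    by (intro Y'.coord_closed_span_eqI)
       (auto simp: ev_bounded \<delta>_def ev_in_X ev_e)
  with assms show ?thesis
    by (simp add: \<delta>_def)
qed

text \<open>The error of a partial sum over \<open>F\<close> is the projection onto
  \<open>A - F\<close>. It annihilates a finitely supported approximant once \<open>F\<close> covers
  the support inside \<open>A\<close>, and contracts the remainder.\<close>

lemma coord_proj_X:
  assumes \<phi>: "\<phi> \<in> vecs X"
  shows "coord_proj X ev A \<phi> = proj A \<phi>"
proof -
  define u where "u j = fscale (\<phi> (e j)) (ev j)" for j
  have uX: "u j \<in> vecs X" for j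
    unfolding u_def using X.subspace_scale[OF X.subspace_vecs ev_in_X] by simp
  have b: "bounded_functional Y \<phi>"
    by (rule X_bounded[OF \<phi>])
  have "((\<lambda>F. nrm (dual Y) (proj A \<phi> - sum u F)) \<longlongrightarrow> 0) (finite_subsets_at_top A)"
  proof (rule tendstoI)
    fix \<epsilon> :: real assume \<epsilon>: "0 < \<epsilon>"
    obtain F0 :: "nat set" and c where
      F0: "finite F0" "nrm (dual Y) (\<phi> - (\<Sum>j\<in>F0. fscale (c j) (ev j))) < \<epsilon>"
      using X_approx[OF \<phi> \<epsilon>] .
    let ?v = "\<Sum>j\<in>F0. fscale (c j) (ev j)"
    have bv: "bounded_functional Y (\<phi> - ?v)"
      using X.subspace_diff[OF X.subspace_vecs \<phi> sum_ev_in_X] by (rule X_bounded)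
    have "dist (nrm (dual Y) (proj A \<phi> - sum u F)) 0 < \<epsilon>"
      if F: "finite F" "F0 \<inter> A \<subseteq> F" "F \<subseteq> A" for F
    proof -
      have "proj A \<phi> - sum u F = proj (A - F) \<phi>"
      proof
        fix y :: "nat \<Rightarrow> 'k"
        have "chop A y = chop (A - F) y + chop F y"
          using F by (auto simp: chop_def fun_eq_iff)
        then show "(proj A \<phi> - sum u F) y = proj (A - F) \<phi> y"
          using Y.bounded_functional_add[OF b, of "chop (A - F) y" "chop F y"]
          by (simp add: u_def proj_finite[OF b F(1), symmetric]) (simp add: proj_def chop_in_Y)
      qed
      moreover have "proj (A - F) ?v = 0"
        unfolding proj_sum_ev using F by (intro sum.neutral) (auto simp: fscale_def)
      ultimately have "proj A \<phi> - sum u F = proj (A - F) (\<phi> - ?v)"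
        by (simp add: proj_diff)
      then have "nrm (dual Y) (proj A \<phi> - sum u F) < \<epsilon>"
        using nrm_proj_le[OF bv, of "A - F"] F0(2) by simp
      moreover have "0 \<le> nrm (dual Y) (proj A \<phi> - sum u F)"
        using \<open>proj A \<phi> - sum u F = proj (A - F) (\<phi> - ?v)\<close> proj_bounded[OF bv] Y'.nrm_ge_0 by simp
      ultimately show ?thesis by simp
    qed
    then show "\<forall>\<^sub>F F in finite_subsets_at_top A. dist (nrm (dual Y) (proj A \<phi> - sum u F)) 0 < \<epsilon>"
      unfolding eventually_finite_subsets_at_top using F0(1)
      by (intro exI[of _ "F0 \<inter> A"]) blast
  qed
  then have "has_nsum X u (proj A \<phi>) A"
    using proj_in_X[OF \<phi>] by (simp add: has_nsum_def)
  then have "(THE g. has_nsum X u g A) = proj A \<phi>"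
    using X.has_nsum_unique uX by (intro the_equality) blast+
  then show ?thesis
    by (simp add: coord_proj_def coord_X[OF \<phi>] u_def[abs_def])
qed

abbreviation adj :: "nat set \<Rightarrow> (((nat \<Rightarrow> 'k) \<Rightarrow> 'k) \<Rightarrow> 'k) \<Rightarrow> ((nat \<Rightarrow> 'k) \<Rightarrow> 'k) \<Rightarrow> 'k" where
  "adj A f \<equiv> adjoint_on X (coord_proj X ev A) f"

lemma adj_ev:
  assumes "bounded_functional X f"
  shows "adj A f (ev j) = (if j \<in> A then f (ev j) else 0)"
  using X.bounded_functional_0[OF assms]
  by (simp add: adjoint_on_def ev_in_X coord_proj_X proj_ev)

lemma adj_bounded:
  assumes f: "bounded_functional X f"
  shows "bounded_functional X (adj A f)"
  unfolding bounded_functional_def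
proof (intro conjI ballI allI impI)
  fix \<phi> \<psi> assume "\<phi> \<in> vecs X" "\<psi> \<in> vecs X"
  then show "adj A f (\<phi> + \<psi>) = adj A f \<phi> + adj A f \<psi>"
    using X.subspace_add[OF X.subspace_vecs]
    by (simp add: adjoint_on_def coord_proj_X proj_add X.bounded_functional_add[OF f] proj_in_X)
next
  fix c \<phi> assume "\<phi> \<in> vecs X"
  then show "adj A f (smul X c \<phi>) = c * adj A f \<phi>"
    using X.subspace_scale[OF X.subspace_vecs, of \<phi> c]
      X.bounded_functional_smul[OF f proj_in_X, of \<phi> c A]
    by (simp add: adjoint_on_def coord_proj_X proj_scale)
next
  have "norm (adj A f \<phi>) \<le> nrm (dual X) f * nrm X \<phi>" if \<phi>: "\<phi> \<in> vecs X" for \<phi>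
  proof -
    have "norm (f (proj A \<phi>)) \<le> nrm (dual X) f * nrm X (proj A \<phi>)"
      by (rule X.norm_le_nrm_dual[OF f proj_in_X[OF \<phi>]])
    also have "\<dots> \<le> nrm (dual X) f * nrm X \<phi>"
      using nrm_proj_le[OF X_bounded[OF \<phi>]] X'.nrm_ge_0[of f] f by (intro mult_left_mono) auto
    finally show ?thesis
      using \<phi> by (simp add: adjoint_on_def coord_proj_X)
  qed
  then show "\<exists>C. \<forall>\<phi>\<in>vecs X. norm (adj A f \<phi>) \<le> C * nrm X \<phi>"
    by blast
qed (simp add: adjoint_on_def)

end

section \<open>Power bounds and Lechner's condition\<close>

context orlicz_function
begin

section \<open>The index \<open>orlicz_alpha\<close> and power bounds\<close>

lemma M_pos:
  assumes "\<not> degenerate M" "0 < b"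
  shows "0 < M b"
proof (rule ccontr)
  assume "\<not> 0 < M b"
  then have "M t = 0" if "0 \<le> t" "t < b" for t
    using M_mono[of t b] M_nonneg[of t] that by linarith
  then have "degenerate M"
    using assms(2) by (auto simp: degenerate_def)
  then show False
    using assms(1) by simp
qed

text \<open>Non-degeneracy makes \<open>M b\<close> positive, so the denominator in
  \<open>orlicz_dilate\<close> can be cleared; a supremum exceeds 1 exactly when some admissible
  exponent does.\<close>

lemma orlicz_alpha_gt_1_iff:
  assumes "\<not> degenerate M"
  shows "1 < orlicz_alpha M \<longleftrightarrow>
    (\<exists>q>1. \<exists>C. \<forall>b t. 0 < b \<longrightarrow> b \<le> 1 \<longrightarrow> 0 < t \<longrightarrow> t \<le> 1 \<longrightarrow> M (b * t) \<le> C * t powr q * M b)"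
proof -
  have *: "t powr (- q) * orlicz_dilate M b t \<le> C \<longleftrightarrow> M (b * t) \<le> C * t powr q * M b"
    if "0 < b" "0 < t" for b t q C
    using M_pos[OF assms \<open>0 < b\<close>] that by (simp add: orlicz_dilate_def powr_minus field_simps)
  have "bdd_above {t powr (- q) * orlicz_dilate M b t | b t. 0 < b \<and> b \<le> 1 \<and> 0 < t \<and> t \<le> 1} \<longleftrightarrow>
    (\<exists>C. \<forall>b t. 0 < b \<longrightarrow> b \<le> 1 \<longrightarrow> 0 < t \<longrightarrow> t \<le> 1 \<longrightarrow> t powr (- q) * orlicz_dilate M b t \<le> C)" for q
    unfolding bdd_above_def by blast
  then have "bdd_above {t powr (- q) * orlicz_dilate M b t | b t. 0 < b \<and> b \<le> 1 \<and> 0 < t \<and> t \<le> 1} \<longleftrightarrow>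
    (\<exists>C. \<forall>b t. 0 < b \<longrightarrow> b \<le> 1 \<longrightarrow> 0 < t \<longrightarrow> t \<le> 1 \<longrightarrow> M (b * t) \<le> C * t powr q * M b)" for q
    using * by (simp cong: imp_cong)
  then show ?thesis
    unfolding orlicz_alpha_def less_SUP_iff by (auto intro: less_imp_le)
qed

lemma power_bound_if_uniform_decrease:
  assumes \<delta>: "0 < \<delta>" "\<delta> < 1"
    and less: "\<And>u. 0 < u \<Longrightarrow> u \<le> 1 \<Longrightarrow> M (u * \<delta>) \<le> \<delta> / 2 * M u"
  shows "\<exists>q>1. \<exists>C. \<forall>b t. 0 < b \<longrightarrow> b \<le> 1 \<longrightarrow> 0 < t \<longrightarrow> t \<le> 1 \<longrightarrow> M (b * t) \<le> C * t powr q * M b"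
proof -
  \<comment> \<open>Chosen so that \<delta> to the power \<open>q\<close> is
    \<open>\<delta> / 2\<close>, the factor gained in each step of the iteration.\<close>
  define q where "q = 1 + log \<delta> (1 / 2)"
  have "q > 1"
    using \<delta> by (simp add: q_def log_def field_simps)
  have \<delta>q: "\<delta> powr q = \<delta> / 2"
    using \<delta> by (simp add: q_def powr_add)
  have iter: "M (b * \<delta> ^ k) \<le> (\<delta> powr q) ^ k * M b" if b: "0 < b" "b \<le> 1" for b k
  proof (induction k)
    case (Suc k)
    have "M (b * \<delta> ^ k * \<delta>) \<le> \<delta> / 2 * M (b * \<delta> ^ k)"
      using \<delta> b by (intro less) (auto simp: mult_le_one power_le_one)
    also have "\<dots> \<le> \<delta> / 2 * ((\<delta> powr q) ^ k * M b)"
      using \<delta> Suc by (intro mult_left_mono) auto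
    finally show ?case
      by (simp add: \<delta>q mult_ac)
  qed simp
  have "M (b * t) \<le> \<delta> powr (- q) * t powr q * M b" if b: "0 < b" "b \<le> 1" and t: "0 < t" "t \<le> 1" for b t
  proof -
    have ex: "\<exists>k. \<delta> ^ k < t"
      using real_arch_pow_inv[OF t(1) \<delta>(2)] .
    \<comment> \<open>The least such \<open>k\<close> places \<open>t\<close> between two
      consecutive powers of \<delta>; it is positive because \<open>t \<le> 1\<close>. Rounding
      \<open>t\<close> up to the larger power costs the constant
      \<open>\<delta> powr (- q)\<close>.\<close>
    define k where "k = (LEAST k. \<delta> ^ k < t)"
    have k: "\<delta> ^ k < t"
      unfolding k_def using ex by (rule LeastI_ex)
    then obtain m where m: "k = Suc m"
      using t(2) by (cases k) auto
    have "t \<le> \<delta> ^ m"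
      using not_less_Least[of m "\<lambda>k. \<delta> ^ k < t"] m by (simp add: k_def)
    then have "M (b * t) \<le> M (b * \<delta> ^ m)"
      using b t by (intro M_mono mult_left_mono) auto
    also have "\<dots> \<le> (\<delta> powr q) ^ m * M b"
      by (rule iter[OF b])
    also have "(\<delta> powr q) ^ m = \<delta> powr (- q) * (\<delta> ^ k) powr q"
      using \<delta> by (simp add: m powr_mult powr_minus powr_realpow[symmetric] powr_powr mult.commute)
    also have "\<dots> * M b \<le> \<delta> powr (- q) * t powr q * M b"
      using k \<delta> \<open>q > 1\<close> M_nonneg[of b] b by (intro mult_right_mono mult_left_mono powr_mono2) auto
    finally show ?thesis .
  qed
  with \<open>q > 1\<close> show ?thesis by blast
qed

end

text \<open>The enumeration of \<open>A\<close> is split along the rows of the pairing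
  bijection.\<close>

lemma infinite_disjoint_family_subsets:
  fixes A :: "nat set"
  assumes "infinite A"
  obtains B :: "nat \<Rightarrow> nat set" where "disjoint_family B" "\<And>n. infinite (B n)" "\<And>n. B n \<subseteq> A"
proof -
  have inj: "inj (enumerate A)"
    using strict_mono_enumerate[OF assms] by (rule strict_mono_imp_inj_on)
  define B where "B n = range (\<lambda>m. enumerate A (prod_encode (n, m)))" for n
  have "inj (\<lambda>m. enumerate A (prod_encode (n, m)))" for n
    by (auto intro!: injI dest!: injD[OF inj])
  then have "infinite (B n)" for n
    unfolding B_def by (rule range_inj_infinite)
  moreover have "disjoint_family B"
    by (auto simp: disjoint_family_on_def B_def dest!: injD[OF inj])
  moreover have "B n \<subseteq> A" for n
    using enumerate_in_set[OF assms] by (auto simp: B_def)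
  ultimately show ?thesis
    using that by blast
qed

section \<open>The two implications\<close>

context orlicz_sequence
begin

text \<open>The coefficients are uniform on the first \<open>N\<close> indices. By disjointness at
  most one \<open>f n\<close> contributes at each coordinate, where the scaling costs a factor
  \<open>K\<close> in the modular; the \<open>N\<close> modulars, each at most 1, then add up to at
  most \<open>N * K \<le> 1\<close>.\<close>

lemma lechner_if_power_bound:
  assumes "1 < q"
    and bound: "\<And>b t. 0 < b \<Longrightarrow> b \<le> 1 \<Longrightarrow> 0 < t \<Longrightarrow> t \<le> 1 \<Longrightarrow> M (b * t) \<le> C * t powr q * M b"
  shows "dual_basis_lechner X ev"
  unfolding dual_basis_lechner_def
proof (intro allI impI)
  fix A :: "nat set" and \<theta> :: real
  assume "infinite A" and \<theta>: "0 < \<theta>"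
  then obtain B :: "nat \<Rightarrow> nat set" where B: "disjoint_family B" "\<And>n. infinite (B n)" "\<And>n. B n \<subseteq> A"
    using infinite_disjoint_family_subsets by blast
  have "0 \<le> C"
    using bound[of 1 1] by simp
  \<comment> \<open>The expression is \<open>N * K\<close> for the \<open>K\<close> defined below;
    the exponent \<open>1 - q\<close> is negative.\<close>
  have "(\<lambda>N. C * \<theta> powr (- q) * real N powr (1 - q)) \<longlonglongrightarrow> C * \<theta> powr (- q) * 0"
    using \<open>1 < q\<close>
    by (intro tendsto_intros tendsto_neg_powr filterlim_real_sequentially) simp
  then have "\<forall>\<^sub>F N in sequentially. C * \<theta> powr (- q) * real N powr (1 - q) < 1"
    by (rule order_tendstoD) simp
  moreover have "\<forall>\<^sub>F N in sequentially. 1 / \<theta> \<le> real N"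
    using filterlim_real_sequentially unfolding filterlim_at_top by blast
  ultimately have ev_N: "\<forall>\<^sub>F N in sequentially.
      C * \<theta> powr (- q) * real N powr (1 - q) < 1 \<and> 1 / \<theta> \<le> real N \<and> 0 < N"
    using eventually_gt_at_top[of "0::nat"] by eventually_elim blast
  obtain N where N: "C * \<theta> powr (- q) * real N powr (1 - q) < 1" "1 / \<theta> \<le> real N" "0 < N"
    using eventually_happens'[OF sequentially_bot ev_N] by blast
  \<comment> \<open>The factor left after averaging over \<open>N\<close> vectors and dividing by
    \<theta>. The choice of \<open>N\<close> keeps it at most 1, as the power bound
    requires.\<close>
  define t where "t = 1 / (real N * \<theta>)"
  have t: "0 < t" "t \<le> 1"
    using N(2,3) \<theta> by (auto simp: t_def field_simps)
  define K where "K = C * t powr q"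
  have "0 \<le> K"
    using \<open>0 \<le> C\<close> by (simp add: K_def)
  have NK: "real N * K \<le> 1"
  proof -
    have "t powr q = \<theta> powr (- q) * real N powr (- q)"
      using \<theta> N(3) by (simp add: t_def powr_divide powr_mult powr_minus_divide)
    moreover have "real N * real N powr (- q) = real N powr (1 - q)"
      using N(3) by (simp add: powr_mult_base)
    ultimately have "real N * K = C * \<theta> powr (- q) * real N powr (1 - q)"
      by (metis K_def mult.assoc mult.left_commute)
    then show ?thesis
      using N(1) by simp
  qed
  show "\<exists>B :: nat \<Rightarrow> nat set. disjoint_family B \<and> (\<forall>n. infinite (B n) \<and> B n \<subseteq> A) \<and>
      (\<forall>f. (\<forall>n. f n \<in> vecs (dual X) \<and> nrm (dual X) (f n) \<le> 1) \<longrightarrow>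
        (\<exists>a. (\<lambda>n. norm (a n)) sums 1 \<and>
          (\<exists>s. has_nsum (dual X) (\<lambda>n. smul (dual X) (a n) (adj (B n) (f n))) s UNIV \<and>
            nrm (dual X) s \<le> \<theta>)))"
  proof (intro exI[of _ B] conjI allI impI)
    fix f :: "nat \<Rightarrow> ((nat \<Rightarrow> 'k) \<Rightarrow> 'k) \<Rightarrow> 'k"
    assume "\<forall>n. f n \<in> vecs (dual X) \<and> nrm (dual X) (f n) \<le> 1"
    then have f: "bounded_functional X (f n)" "nrm (dual X) (f n) \<le> 1" for n
      by auto
    have mod: "(\<Sum>j\<in>F. M (norm (f n (ev j)))) \<le> 1" if "finite F" for F n
      using modular_le_of_functional[OF f _ that, of n] by simp
    define a :: "nat \<Rightarrow> 'k" where "a n = (if n < N then 1 / of_nat N else 0)" for n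
    define u where "u n = fscale (a n) (adj (B n) (f n))" for n
    have u: "u n \<in> vecs (dual X)" for n
      using X'.subspace_scale[OF X'.subspace_vecs, of "adj (B n) (f n)" "a n"] adj_bounded[OF f(1)]
      by (simp add: u_def)
    define s where "s = sum u {..<N}"
    have s_ev: "s (ev j) = (\<Sum>n<N. if j \<in> B n then f n (ev j) / of_nat N else 0)" for j
    proof -
      have sum_apply: "sum u G (ev j) = (\<Sum>n\<in>G. u n (ev j))" for G
        by (induction G rule: infinite_finite_induct) auto
      show ?thesis
        unfolding s_def sum_apply
        by (intro sum.cong) (auto simp: u_def a_def fscale_def adj_ev[OF f(1)])
    qed
    have pointwise: "M (norm (s (ev j)) / \<theta>) \<le> (\<Sum>n<N. K * M (norm (f n (ev j))))" for j
    proof (cases "\<exists>n<N. j \<in> B n")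
      case True
      then obtain n where n: "n < N" "j \<in> B n" by blast
      have "j \<in> B m \<longleftrightarrow> m = n" for m
        using n(2) B(1) by (auto simp: disjoint_family_on_def)
      then have "s (ev j) = f n (ev j) / of_nat N"
        using n(1) by (simp add: s_ev)
      then have "norm (s (ev j)) / \<theta> = norm (f n (ev j)) * t"
        by (simp add: t_def norm_divide)
      also have "M \<dots> \<le> K * M (norm (f n (ev j)))"
      proof (cases "f n (ev j) = 0")
        case False
        \<comment> \<open>This modulus plays the role of \<open>b\<close> in the power bound, which
          is available for \<open>b \<le> 1\<close> only.\<close>
        have "norm (f n (ev j)) \<le> 1"
          using mod[of "{j}" n] by (intro le_1_if_M_le_1[of "norm (f n (ev j))"]) auto
        then show ?thesis
          unfolding K_def using False t by (intro bound) auto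
      qed simp
      also have "\<dots> \<le> (\<Sum>n<N. K * M (norm (f n (ev j))))"
        using n(1) \<open>0 \<le> K\<close> M_nonneg by (intro member_le_sum[of n "{..<N}" "\<lambda>n. K * M (norm (f n (ev j)))"]) auto
      finally show ?thesis .
    next
      case False
      then have "s (ev j) = 0"
        unfolding s_ev by (intro sum.neutral) auto
      then show ?thesis
        using \<open>0 \<le> K\<close> M_nonneg by (simp add: sum_nonneg)
    qed
    have "nrm (dual X) s \<le> \<theta>"
    proof (rule functional_norm_le)
      show "bounded_functional X s"
        using X'.subspace_sum[OF X'.subspace_vecs, of "{..<N}" u] u by (simp add: s_def)
    next
      fix F :: "nat set" assume F: "finite F"
      have "(\<Sum>j\<in>F. M (norm (s (ev j)) / \<theta>)) \<le> (\<Sum>j\<in>F. \<Sum>n<N. K * M (norm (f n (ev j))))"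
        by (intro sum_mono pointwise)
      also have "\<dots> = (\<Sum>n<N. K * (\<Sum>j\<in>F. M (norm (f n (ev j)))))"
        unfolding sum_distrib_left by (rule sum.swap)
      also have "\<dots> \<le> (\<Sum>n<N. K * 1)"
        using mod[OF F] \<open>0 \<le> K\<close> by (intro sum_mono mult_left_mono) auto
      also have "\<dots> \<le> 1"
        using NK by simp
      finally show "(\<Sum>j\<in>F. M (norm (s (ev j)) / \<theta>)) \<le> 1" .
    qed fact
    moreover have "has_nsum (dual X) u s UNIV"
    proof -
      have "u n = 0" if "n \<notin> {..<N}" for n
        using that by (auto simp: u_def a_def fscale_def)
      then show ?thesis
        unfolding s_def using u by (intro X'.has_nsum_finite_support) auto
    qed
    moreover have "(\<lambda>n. norm (a n)) sums (\<Sum>n<N. norm (a n))"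
      by (rule sums_finite) (auto simp: a_def)
    then have "(\<lambda>n. norm (a n)) sums 1"
      using N(3) by (simp add: a_def norm_divide)
    ultimately show "\<exists>a. (\<lambda>n. norm (a n)) sums 1 \<and>
        (\<exists>s. has_nsum (dual X) (\<lambda>n. smul (dual X) (a n) (adj (B n) (f n))) s UNIV \<and>
          nrm (dual X) s \<le> \<theta>)"
      unfolding u_def by auto
  qed (use B in auto)
qed

text \<open>Norm convergence implies convergence at \<phi>, where every partial sum containing
  \<open>m\<close> has the same value. It serves to read off the coordinates of a series with
  disjoint supports.\<close>

lemma has_nsum_dual_apply:
  assumes sum: "has_nsum (dual X) g s UNIV" and g: "\<And>n. g n \<in> vecs (dual X)"
    and \<phi>: "\<phi> \<in> vecs X" and zero: "\<And>n. n \<noteq> m \<Longrightarrow> g n \<phi> = 0"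
  shows "s \<phi> = g m \<phi>"
proof -
  have s: "s \<in> vecs (dual X)" and lim: "((\<lambda>F. nrm (dual X) (s - sum g F)) \<longlongrightarrow> 0) (finite_subsets_at_top UNIV)"
    using sum by (auto simp: has_nsum_def)
  have "((\<lambda>F. nrm (dual X) (s - sum g F) * nrm X \<phi>) \<longlongrightarrow> 0 * nrm X \<phi>) (finite_subsets_at_top UNIV)"
    by (intro tendsto_mult lim tendsto_const)
  then have "norm (s \<phi> - g m \<phi>) \<le> 0 * nrm X \<phi>"
  proof (rule tendsto_lowerbound)
    have "norm (s \<phi> - g m \<phi>) \<le> nrm (dual X) (s - sum g F) * nrm X \<phi>" if F: "finite F" "{m} \<subseteq> F" for F
    proof -
      have "sum g G \<phi> = (\<Sum>n\<in>G. g n \<phi>)" for G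
        by (induction G rule: infinite_finite_induct) auto
      also have "(\<Sum>n\<in>F. g n \<phi>) = (\<Sum>n\<in>{m}. g n \<phi>)"
        using F zero by (intro sum.mono_neutral_right) auto
      finally have "(s - sum g F) \<phi> = s \<phi> - g m \<phi>" by simp
      moreover have "bounded_functional X (s - sum g F)"
        using X'.subspace_diff[OF X'.subspace_vecs s X'.subspace_sum[OF X'.subspace_vecs g]] by simp
      ultimately show ?thesis
        using X.norm_le_nrm_dual[OF _ \<phi>] by metis
    qed
    then show "\<forall>\<^sub>F F in finite_subsets_at_top UNIV.
        norm (s \<phi> - g m \<phi>) \<le> nrm (dual X) (s - sum g F) * nrm X \<phi>"
      unfolding eventually_finite_subsets_at_top by (intro exI[of _ "{m}"]) blast
  qed simp
  then show ?thesis by simp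
qed

text \<open>The natural embedding of \<open>Y\<close> into the dual of \<open>X\<close>; it provides
  the functionals that test Lechner's condition.\<close>

lemma eval_bounded:
  assumes w: "w \<in> vecs Y"
  shows "bounded_functional X (\<lambda>\<phi>. if \<phi> \<in> vecs X then \<phi> w else 0)" (is "bounded_functional X ?f")
    and "nrm (dual X) (\<lambda>\<phi>. if \<phi> \<in> vecs X then \<phi> w else 0) \<le> nrm Y w"
proof -
  have le: "norm (?f \<phi>) \<le> nrm Y w * nrm X \<phi>" if "\<phi> \<in> vecs X" for \<phi>
    using Y.norm_le_nrm_dual[OF X_bounded[OF that] w] that by (simp add: mult.commute)
  have "fscale c \<phi> \<in> vecs X" if "\<phi> \<in> vecs X" for c \<phi>
    using X.subspace_scale[OF X.subspace_vecs that] by simp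
  moreover have "\<exists>C. \<forall>\<phi>\<in>vecs X. norm (?f \<phi>) \<le> C * nrm X \<phi>"
    using le by blast
  ultimately show "bounded_functional X ?f"
    unfolding bounded_functional_def
    using X.subspace_add[OF X.subspace_vecs] by (auto simp: fscale_def)
  show "nrm (dual X) ?f \<le> nrm Y w"
    using le Y.nrm_ge_0[OF w] by (rule X.nrm_dual_le')
qed

text \<open>
  A sequence of disjoint vectors \<open>u n * indicator (S n)\<close> of norm at most one whose
  modular dominates \<open>\<bar>a\<bar> / 4\<close> down to \<open>\<bar>a\<bar> = \<delta> n\<close>, where the \<open>\<delta> n\<close> have sum \<open>1 / 2\<close>,
  spans a copy of \<open>\<ell>\<^sub>1\<close> uniformly.
\<close>

lemma power_bound_if_lechner:
  assumes lechner: "dual_basis_lechner X ev" and nondeg: "\<not> degenerate M"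
  shows "\<exists>q>1. \<exists>C. \<forall>b t. 0 < b \<longrightarrow> b \<le> 1 \<longrightarrow> 0 < t \<longrightarrow> t \<le> 1 \<longrightarrow> M (b * t) \<le> C * t powr q * M b"
proof (rule ccontr)
  assume contra: "\<not> ?thesis"
  define \<delta> where "\<delta> n = (1 / 2 :: real) ^ (n + 2)" for n :: nat
  have \<delta>: "0 < \<delta> n" "\<delta> n < 1" for n
    using power_Suc_less_one[of "1 / 2 :: real" "Suc n"] by (simp_all add: \<delta>_def)
  have sum_\<delta>: "(\<Sum>n<N. \<delta> n) = 1 / 2 - (1 / 2) ^ (N + 1)" for N
    by (induction N) (auto simp: \<delta>_def)
  \<comment> \<open>Contrapositive of \<open>power_bound_if_uniform_decrease\<close> with ratio
    \<open>\<delta> n\<close>.\<close>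
  have "\<exists>u. 0 < u \<and> u \<le> 1 \<and> \<delta> n / 2 * M u \<le> M (u * \<delta> n)" for n
    using power_bound_if_uniform_decrease[OF \<delta>, of n] contra by (meson linear)
  then obtain u where u: "\<And>n. 0 < u n" "\<And>n. u n \<le> 1" and u_le: "\<And>n. \<delta> n / 2 * M (u n) \<le> M (u n * \<delta> n)"
    by metis
  have Mu: "0 < M (u n)" "M (u n) \<le> 1" for n
    using M_pos[OF nondeg u(1)] M_mono[of "u n" 1] u by (auto intro: less_imp_le)
  \<comment> \<open>The number of copies of \<open>u n\<close> that brings the modular of the block
    between 1/2 and 1; the lower bound holds because rounding down a number that is at least 1 loses
    at most half of it.\<close>
  define k where "k n = nat \<lfloor>1 / M (u n)\<rfloor>" for n
  have k: "real (k n) * M (u n) \<le> 1" "1 / 2 \<le> real (k n) * M (u n)" for n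
  proof -
    have ge1: "1 \<le> 1 / M (u n)"
      using Mu[of n] by simp
    then have kn: "real (k n) = of_int \<lfloor>1 / M (u n)\<rfloor>"
      unfolding k_def by (intro of_nat_nat) linarith
    then have kn1: "1 \<le> real (k n)"
      unfolding kn using ge1 by simp
    have "real (k n) \<le> 1 / M (u n)" "1 / M (u n) < real (k n) + 1"
      unfolding kn by linarith+
    then have "real (k n) \<le> 1 / M (u n)" "1 / M (u n) \<le> 2 * real (k n)"
      using kn1 by linarith+
    then show "real (k n) * M (u n) \<le> 1" "1 / 2 \<le> real (k n) * M (u n)"
      using Mu(1)[of n] by (simp_all add: field_simps)
  qed
  obtain B :: "nat \<Rightarrow> nat set" where B: "disjoint_family B" "\<And>n. infinite (B n)"
    and B_lechner: "\<And>f. (\<And>n. bounded_functional X (f n) \<and> nrm (dual X) (f n) \<le> 1) \<Longrightarrow>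
        \<exists>a. (\<lambda>n. norm (a n)) sums 1 \<and>
          (\<exists>s. has_nsum (dual X) (\<lambda>n. fscale (a n) (adj (B n) (f n))) s UNIV \<and> nrm (dual X) s \<le> 1 / 16)"
    using lechner unfolding dual_basis_lechner_def dual_simps mem_Collect_eq
    by (auto dest!: spec[of _ "UNIV :: nat set"] spec[of _ "1 / 16 :: real"])
  have "\<exists>S. finite S \<and> card S = k n \<and> S \<subseteq> B n" for n
    using infinite_arbitrarily_large[OF B(2)] by blast
  then obtain S where S: "\<And>n. finite (S n)" "\<And>n. card (S n) = k n" "\<And>n. S n \<subseteq> B n"
    by metis
  define w :: "nat \<Rightarrow> nat \<Rightarrow> 'k" where "w n = chop (S n) (\<lambda>_. of_real (u n))" for n
  have wY: "w n \<in> vecs Y" for n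
    unfolding w_def by (rule finite_support_in_Y[OF S(1)])
  have "nrm Y (w n) \<le> 1" for n
  proof -
    have "1 \<in> orlicz_radii M (w n)"
      unfolding orlicz_radii_iff
    proof (intro conjI allI impI)
      fix F :: "nat set" assume F: "finite F"
      have "(\<Sum>j\<in>F. M (norm (w n j) / 1)) = (\<Sum>j\<in>F. if j \<in> S n then M (u n) else 0)"
        using u(1)[of n] by (intro sum.cong) (auto simp: w_def chop_def)
      also have "\<dots> = (\<Sum>j\<in>F \<inter> S n. M (u n))"
        using F by (rule sum.inter_restrict[symmetric])
      also have "\<dots> \<le> (\<Sum>j\<in>S n. M (u n))"
        using Mu(1)[of n] S(1) by (intro sum_mono2) auto
      also have "\<dots> \<le> 1"
        using k(1) by (simp add: S(2))
      finally show "(\<Sum>j\<in>F. M (norm (w n j) / 1)) \<le> 1" .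
    qed simp
    then show ?thesis
      by (simp add: orlicz_norm_le)
  qed
  define f where "f n \<phi> = (if \<phi> \<in> vecs X then \<phi> (w n) else 0)" for n \<phi>
  have f: "bounded_functional X (f n)" "nrm (dual X) (f n) \<le> 1" for n
    using eval_bounded[OF wY, of n] \<open>nrm Y (w n) \<le> 1\<close> unfolding f_def by auto
  obtain a s where a: "(\<lambda>n. norm (a n)) sums 1"
    and s: "has_nsum (dual X) (\<lambda>n. fscale (a n) (adj (B n) (f n))) s UNIV" "nrm (dual X) s \<le> 1 / 16"
    using B_lechner[of f] f by blast
  have s_ev: "s (ev j) = a n * of_real (u n)" if j: "j \<in> S n" for j n
  proof -
    have "j \<in> B m \<longleftrightarrow> m = n" for m
      using j S(3)[of n] B(1) unfolding disjoint_family_on_def by blast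
    moreover have "fscale (a m) (adj (B m) (f m)) \<in> vecs (dual X)" for m
      using X'.subspace_scale[OF X'.subspace_vecs, of "adj (B m) (f m)" "a m"] adj_bounded[OF f(1)]
      by simp
    ultimately have "s (ev j) = fscale (a n) (adj (B n) (f n)) (ev j)"
      by (intro has_nsum_dual_apply[OF s(1) _ ev_in_X]) (auto simp: fscale_def adj_ev[OF f(1)])
    also have "\<dots> = a n * w n j"
      using j S(3)[of n] wY[of n] by (auto simp: fscale_def adj_ev[OF f(1)] f_def ev_in_X ev_def)
    also have "w n j = of_real (u n)"
      using j by (simp add: w_def chop_def)
    finally show ?thesis .
  qed
  \<comment> \<open>Dividing by 1/16 multiplies the coordinates on \<open>S n\<close> by 16.
    Monotonicity of \<open>M t / t\<close> from \<open>u n * \<delta> n\<close> upwards and the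
    choice of \<open>u n\<close> give \<open>8 * norm (a n) * M (u n)\<close> per coordinate, and
    the block has modular at least 1/2. If \<open>a n\<close> is smaller than
    \<open>\<delta> n\<close>, the left side is negative.\<close>
  have lower: "4 * (norm (a n) - \<delta> n) \<le> (\<Sum>j\<in>S n. M (norm (s (ev j)) / (1 / 16)))" for n
  proof (cases "\<delta> n \<le> norm (a n)")
    case True
    then have pos: "0 < norm (a n)"
      using \<delta>(1)[of n] by linarith
    have "M (u n * \<delta> n) = M (\<delta> n / (16 * norm (a n)) * (16 * (norm (a n) * u n)))"
      using pos by (simp add: field_simps)
    also have "\<dots> \<le> \<delta> n / (16 * norm (a n)) * M (16 * (norm (a n) * u n))"
      using True pos \<delta>(1)[of n] u(1)[of n] by (intro M_mult_le) (auto simp: field_simps)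
    finally have "\<delta> n / 2 * M (u n) \<le> \<delta> n / (16 * norm (a n)) * M (16 * (norm (a n) * u n))"
      using u_le[of n] by linarith
    then have "8 * norm (a n) * M (u n) \<le> M (16 * (norm (a n) * u n))"
      using pos \<delta>(1)[of n] by (simp add: field_simps)
    then have "real (k n) * (8 * norm (a n) * M (u n)) \<le> real (k n) * M (16 * (norm (a n) * u n))"
      by (rule mult_left_mono) simp
    moreover have "8 * norm (a n) * (1 / 2) \<le> 8 * norm (a n) * (real (k n) * M (u n))"
      using k(2)[of n] by (rule mult_left_mono) simp
    moreover have "(\<Sum>j\<in>S n. M (norm (s (ev j)) / (1 / 16))) = real (k n) * M (16 * (norm (a n) * u n))"
      using u(1)[of n] by (simp add: s_ev norm_mult S(2) mult_ac)
    ultimately show ?thesis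
      using \<delta>(1)[of n] by (simp add: algebra_simps)
  next
    case False
    have "0 \<le> (\<Sum>j\<in>S n. M (norm (s (ev j)) / (1 / 16)))"
      by (intro sum_nonneg M_nonneg) simp
    with False show ?thesis by simp
  qed
  \<comment> \<open>The blocks share one modular budget of 1, which gives 1/4; the thresholds
    \<open>\<delta> n\<close> contribute at most 1/2. The total stays below the required 1.\<close>
  have "(\<Sum>n<N. norm (a n)) \<le> 3 / 4" for N
  proof -
    have disj: "S m \<inter> S n = {}" if "m \<noteq> n" for m n
      using B(1) S(3) that unfolding disjoint_family_on_def by blast
    have "(\<Sum>n<N. 4 * (norm (a n) - \<delta> n)) \<le> (\<Sum>n<N. \<Sum>j\<in>S n. M (norm (s (ev j)) / (1 / 16)))"
      by (intro sum_mono lower)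
    also have "\<dots> = (\<Sum>j\<in>(\<Union>n<N. S n). M (norm (s (ev j)) / (1 / 16)))"
      using S(1) disj by (intro sum.UNION_disjoint[symmetric]) auto
    also have "\<dots> \<le> 1"
      using s S(1) by (intro modular_le_of_functional) (auto simp: has_nsum_def)
    finally have "4 * ((\<Sum>n<N. norm (a n)) - (\<Sum>n<N. \<delta> n)) \<le> 1"
      by (simp add: sum_distrib_left[symmetric] sum_subtractf)
    moreover have "(\<Sum>n<N. \<delta> n) \<le> 1 / 2"
      unfolding sum_\<delta> by simp
    ultimately show ?thesis by argo
  qed
  then have "1 \<le> (3 / 4 :: real)"
    using a unfolding sums_def by (intro LIMSEQ_le_const2) auto
  then show False by simp
qed

lemma lechner_condition_orlicz_iff:
  assumes "\<not> degenerate M"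
  shows "lechner_condition L e \<longleftrightarrow> 1 < orlicz_alpha M"
  unfolding lechner_condition_iff orlicz_alpha_gt_1_iff[OF assms]
  using lechner_if_power_bound power_bound_if_lechner[OF _ assms] by blast

end

theorem theorem4p8:
  fixes M :: "real \<Rightarrow> real"
  assumes "normalized_convex_orlicz M"
    and "\<not> degenerate M"
  shows "(lechner_condition (orlicz_space M) (unit_vector :: nat \<Rightarrow> nat \<Rightarrow> real)
            \<longleftrightarrow> 1 < orlicz_alpha M) \<and>
         (lechner_condition (orlicz_space M) (unit_vector :: nat \<Rightarrow> nat \<Rightarrow> complex)
            \<longleftrightarrow> 1 < orlicz_alpha M)"
proof -
  interpret orlicz_function M
    by unfold_locales (rule assms)
  interpret R: orlicz_sequence M "TYPE(real)" ..
  interpret C: orlicz_sequence M "TYPE(complex)" ..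
  show ?thesis
    using R.lechner_condition_orlicz_iff[OF assms(2)] C.lechner_condition_orlicz_iff[OF assms(2)]
    by blast
qed

end
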